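(* Let $\Omega$ be a finite set and let $G\le\mathrm{Sym}(\Omega)$ be a nilpotent permutation group. Then the $2$-closure $\overline{G}$ is nilpotent. Moreover, $$\overline{G}=\prod_{P\in\mathrm{Syl}(G)}\overline{P},$$ where the product is a product of subgroups of $\mathrm{Sym}(\Omega)$.
   Context: For a finite set $\Omega$ and a permutation group $H\le\mathrm{Sym}(\Omega)$, $\mathrm{Orb}_2(H)$ denotes the set of orbits of the induced (componentwise) action of $H$ on $\Omega\times\Omega$. The $2$-closure $\overline{H}$ of $H$ is the largest subgroup of $\mathrm{Sym}(\Omega)$ such that $\mathrm{Orb}_2(\overline{H})=\mathrm{Orb}_2(H)$. $\mathrm{Syl}(G)$ is the set of all Sylow subgroups of $G$ (one for each prime dividing $|G|$, since $G$ is nilpotent). For $P\in\mathrm{Syl}(G)$, $\overline{P}$ is the $2$-closure of $P$ as a subgroup of $\mathrm{Sym}(\Omega)$. *)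

theory Defs
  imports
    "HOL-Algebra.Bij"
    "HOL-Algebra.Coset"
    "HOL-Algebra.Group_Action"
    "HOL-Algebra.Generated_Groups"
    "HOL-Computational_Algebra.Primes"
begin

text \<open>
  \<open>Sym(\<Omega>)\<close> is \<^const>\<open>BijGroup\<close> \<open>\<Omega>\<close>: permutations of \<open>\<Omega>\<close> are functions that are
  undefined outside \<open>\<Omega>\<close>. A subgroup \<open>H\<close>, viewed as a group in its own right, is
  \<open>(BijGroup \<Omega>)\<lparr>carrier := H\<rparr>\<close>.
\<close>

definition pair_action :: "'a set \<Rightarrow> ('a \<Rightarrow> 'a) \<Rightarrow> 'a \<times> 'a \<Rightarrow> 'a \<times> 'a" where
  "pair_action \<Omega> g = (\<lambda>z \<in> \<Omega> \<times> \<Omega>. map_prod g g z)"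

definition orb2 :: "'a set \<Rightarrow> ('a \<Rightarrow> 'a) set \<Rightarrow> ('a \<times> 'a) set set" where
  "orb2 \<Omega> H = orbits ((BijGroup \<Omega>)\<lparr>carrier := H\<rparr>) (\<Omega> \<times> \<Omega>) (pair_action \<Omega>)"

definition two_closure :: "'a set \<Rightarrow> ('a \<Rightarrow> 'a) set \<Rightarrow> ('a \<Rightarrow> 'a) set" where
  "two_closure \<Omega> H = (GREATEST K. subgroup K (BijGroup \<Omega>) \<and> orb2 \<Omega> K = orb2 \<Omega> H)"

fun lower_central :: "('a, 'b) monoid_scheme \<Rightarrow> nat \<Rightarrow> 'a set" where
  "lower_central G 0 = carrier G"
| "lower_central G (Suc n) =
     generate G (\<Union>x \<in> lower_central G n. \<Union>y \<in> carrier G.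
       {x \<otimes>\<^bsub>G\<^esub> y \<otimes>\<^bsub>G\<^esub> inv\<^bsub>G\<^esub> x \<otimes>\<^bsub>G\<^esub> inv\<^bsub>G\<^esub> y})"

definition nilpotent_group :: "('a, 'b) monoid_scheme \<Rightarrow> bool" where
  "nilpotent_group G \<longleftrightarrow> group G \<and> (\<exists>n. lower_central G n = {\<one>\<^bsub>G\<^esub>})"

text \<open>Only meaningful for finite groups. Primes not dividing the order are excluded, so the
  trivial group has no Sylow subgroups.\<close>

definition sylow_subgroups :: "('a, 'b) monoid_scheme \<Rightarrow> 'a set set" where
  "sylow_subgroups G =
     {P. subgroup P G \<and>
         (\<exists>p::nat. prime p \<and> p dvd order G \<and> card P = p ^ multiplicity p (order G))}"

text \<open>Setwise product \<open>H\<^sub>1 H\<^sub>2 \<dots> H\<^sub>k\<close> in the order of the list. For an unordered family,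
  quantify over all its enumerations.\<close>

definition subgroups_product :: "('a, 'b) monoid_scheme \<Rightarrow> 'a set list \<Rightarrow> 'a set" where
  "subgroups_product G Hs = foldr (\<lambda>H K. H <#>\<^bsub>G\<^esub> K) Hs {\<one>\<^bsub>G\<^esub>}"


text \<open>The rest shows that \<^const>\<open>two_closure\<close> is well defined, that is, that the greatest
  subgroup in its definition exists.\<close>

lemma pair_action_apply [simp]:
  "x \<in> \<Omega> \<Longrightarrow> y \<in> \<Omega> \<Longrightarrow> pair_action \<Omega> g (x, y) = (g x, g y)"
  by (simp add: pair_action_def)

lemma mem_orbit_iff:
  "w \<in> orbit ((BijGroup \<Omega>)\<lparr>carrier := K\<rparr>) \<phi> z \<longleftrightarrow> (\<exists>g \<in> K. w = \<phi> g z)"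
  by (auto simp: orbit_def)

lemma group_action_pair_action:
  assumes H: "subgroup H (BijGroup \<Omega>)"
  shows "group_action ((BijGroup \<Omega>)\<lparr>carrier := H\<rparr>) (\<Omega> \<times> \<Omega>) (pair_action \<Omega>)"
proof -
  have HB: "h \<in> Bij \<Omega>" if "h \<in> H" for h
    using subgroup.mem_carrier[OF H that] by (simp add: BijGroup_def)
  have pB: "pair_action \<Omega> h \<in> Bij (\<Omega> \<times> \<Omega>)" if "h \<in> Bij \<Omega>" for h
  proof -
    have "bij_betw h \<Omega> \<Omega>" using that by (simp add: Bij_def)
    then have "bij_betw (map_prod h h) (\<Omega> \<times> \<Omega>) (\<Omega> \<times> \<Omega>)"
      by (rule bij_betw_map_prod) fact
    then show ?thesis
      by (simp add: Bij_def pair_action_def)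
  qed
  have mult: "pair_action \<Omega> (compose \<Omega> g h) =
      compose (\<Omega> \<times> \<Omega>) (pair_action \<Omega> g) (pair_action \<Omega> h)" if "h \<in> Bij \<Omega>" for g h
    using Bij_imp_funcset[OF that]
    by (intro ext) (auto simp: pair_action_def compose_def restrict_def)
  have "pair_action \<Omega> \<in> hom ((BijGroup \<Omega>)\<lparr>carrier := H\<rparr>) (BijGroup (\<Omega> \<times> \<Omega>))"
    using HB pB mult by (auto simp: hom_def BijGroup_def)
  then show ?thesis
    using group.subgroup_imp_group[OF group_BijGroup H] group_BijGroup[of "\<Omega> \<times> \<Omega>"]
    by (simp add: group_action_def group_hom_def group_hom_axioms_def)
qed

lemma orb2_eq_imp_mem_orbit:
  assumes H: "subgroup H (BijGroup \<Omega>)" and K: "subgroup K (BijGroup \<Omega>)"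
    and eq: "orb2 \<Omega> K = orb2 \<Omega> H" and "f \<in> K" and z: "z \<in> \<Omega> \<times> \<Omega>"
  shows "pair_action \<Omega> f z \<in> orbit ((BijGroup \<Omega>)\<lparr>carrier := H\<rparr>) (pair_action \<Omega>) z"
proof -
  let ?oH = "orbit ((BijGroup \<Omega>)\<lparr>carrier := H\<rparr>) (pair_action \<Omega>)"
  let ?oK = "orbit ((BijGroup \<Omega>)\<lparr>carrier := K\<rparr>) (pair_action \<Omega>)"
  interpret A: group_action "(BijGroup \<Omega>)\<lparr>carrier := H\<rparr>" "\<Omega> \<times> \<Omega>" "pair_action \<Omega>"
    by (rule group_action_pair_action[OF H])
  interpret B: group_action "(BijGroup \<Omega>)\<lparr>carrier := K\<rparr>" "\<Omega> \<times> \<Omega>" "pair_action \<Omega>"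
    by (rule group_action_pair_action[OF K])
  have fz: "pair_action \<Omega> f z \<in> ?oK z"
    using \<open>f \<in> K\<close> by (auto simp: orbit_def)
  have fX: "pair_action \<Omega> f z \<in> \<Omega> \<times> \<Omega>"
    using B.element_image[of f z] \<open>f \<in> K\<close> z by simp
  have "?oK z \<in> orb2 \<Omega> K"
    using z unfolding orb2_def orbits_def by blast
  then have "?oK z \<in> orb2 \<Omega> H"
    unfolding eq .
  then obtain w where w: "w \<in> \<Omega> \<times> \<Omega>" "?oK z = ?oH w"
    unfolding orb2_def orbits_def by blast
  have "z \<in> ?oH w" using B.orbit_refl[OF z] w by simp
  then have "w \<in> ?oH z" by (rule A.orbit_sym[OF w(1) z])
  moreover have "pair_action \<Omega> f z \<in> ?oH w" using fz w by simp
  ultimately show ?thesis by (rule A.orbit_trans[OF z w(1) fX])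
qed

lemma two_closure_eq:
  assumes H: "subgroup H (BijGroup \<Omega>)"
  shows "two_closure \<Omega> H = {f \<in> Bij \<Omega>. \<forall>z \<in> \<Omega> \<times> \<Omega>.
      pair_action \<Omega> f z \<in> orbit ((BijGroup \<Omega>)\<lparr>carrier := H\<rparr>) (pair_action \<Omega>) z}" (is "_ = ?C")
    and subgroup_two_closure: "subgroup (two_closure \<Omega> H) (BijGroup \<Omega>)"
    and orb2_two_closure: "orb2 \<Omega> (two_closure \<Omega> H) = orb2 \<Omega> H"
    and two_closure_greatest:
      "\<And>K. subgroup K (BijGroup \<Omega>) \<Longrightarrow> orb2 \<Omega> K = orb2 \<Omega> H \<Longrightarrow> K \<subseteq> two_closure \<Omega> H"
proof -
  let ?oH = "orbit ((BijGroup \<Omega>)\<lparr>carrier := H\<rparr>) (pair_action \<Omega>)"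
  interpret S: group "BijGroup \<Omega>" by (rule group_BijGroup)
  interpret A: group_action "(BijGroup \<Omega>)\<lparr>carrier := H\<rparr>" "\<Omega> \<times> \<Omega>" "pair_action \<Omega>"
    by (rule group_action_pair_action[OF H])
  interpret F: group_action "(BijGroup \<Omega>)\<lparr>carrier := Bij \<Omega>\<rparr>" "\<Omega> \<times> \<Omega>" "pair_action \<Omega>"
    using group_action_pair_action[OF S.subgroup_self] by (simp add: BijGroup_def)
  have img: "pair_action \<Omega> f z \<in> \<Omega> \<times> \<Omega>" if "f \<in> Bij \<Omega>" "z \<in> \<Omega> \<times> \<Omega>" for f z
    using F.element_image[of f z] that by simp
  have cB: "carrier (BijGroup \<Omega>) = Bij \<Omega>" by (simp add: BijGroup_def)
  have HB: "H \<subseteq> Bij \<Omega>" using subgroup.subset[OF H] by (simp add: BijGroup_def)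
  have CD: "pair_action \<Omega> f z \<in> ?oH z" if "f \<in> ?C" "z \<in> \<Omega> \<times> \<Omega>" for f z
    using that(1) unfolding mem_Collect_eq by (rule conjE) (erule bspec[OF _ that(2)])
  have CI: "f \<in> ?C" if "f \<in> Bij \<Omega>"
    "\<And>z. z \<in> \<Omega> \<times> \<Omega> \<Longrightarrow> pair_action \<Omega> f z \<in> ?oH z" for f
    unfolding mem_Collect_eq by (intro conjI ballI that)
  have HC: "H \<subseteq> ?C" using HB by (auto simp: orbit_def)
  have C1: "?C \<noteq> {}" using HC subgroup.one_closed[OF H] by blast
  have Cinv: "inv\<^bsub>BijGroup \<Omega>\<^esub> f \<in> ?C" if f: "f \<in> ?C" for f
  proof -
    have fB: "f \<in> Bij \<Omega>" using f by simp
    have fi: "inv\<^bsub>BijGroup \<Omega>\<^esub> f \<in> Bij \<Omega>"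
      using S.inv_closed[of f] fB unfolding cB .
    have "pair_action \<Omega> (inv\<^bsub>BijGroup \<Omega>\<^esub> f) z \<in> ?oH z" if z: "z \<in> \<Omega> \<times> \<Omega>" for z
    proof -
      let ?y = "pair_action \<Omega> (inv\<^bsub>BijGroup \<Omega>\<^esub> f) z"
      have y: "?y \<in> \<Omega> \<times> \<Omega>" by (rule img[OF fi z])
      have ff: "f ` \<Omega> = \<Omega>" using fB by (simp add: Bij_def bij_betw_def)
      have i: "f (inv_into \<Omega> f x) = x" "inv_into \<Omega> f x \<in> \<Omega>" if "x \<in> \<Omega>" for x
        using f_inv_into_f[of x f \<Omega>] inv_into_into[of x f \<Omega>] that unfolding ff by simp_all
      obtain a b where ab: "z = (a, b)" "a \<in> \<Omega>" "b \<in> \<Omega>" using z by blast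
      have "pair_action \<Omega> f ?y = z"
        using ab(2,3) i unfolding ab(1) inv_BijGroup[OF fB] by simp
      moreover have "pair_action \<Omega> f ?y \<in> ?oH ?y" by (rule CD[OF f y])
      ultimately have "z \<in> ?oH ?y" by simp
      then show ?thesis by (rule A.orbit_sym[OF y z])
    qed
    with fi show ?thesis by (rule CI)
  qed
  have Cmult: "f \<otimes>\<^bsub>BijGroup \<Omega>\<^esub> g \<in> ?C" if f: "f \<in> ?C" and g: "g \<in> ?C" for f g
  proof -
    have B: "f \<in> Bij \<Omega>" "g \<in> Bij \<Omega>" using f g by simp_all
    have "pair_action \<Omega> (compose \<Omega> f g) z \<in> ?oH z" if z: "z \<in> \<Omega> \<times> \<Omega>" for z
    proof -
      have gz: "pair_action \<Omega> g z \<in> \<Omega> \<times> \<Omega>" by (rule img[OF B(2) z])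
      have 1: "pair_action \<Omega> (compose \<Omega> f g) z = pair_action \<Omega> f (pair_action \<Omega> g z)"
        using z gz by (cases z) (simp add: pair_action_def compose_def)
      have 2: "pair_action \<Omega> g z \<in> ?oH z" by (rule CD[OF g z])
      have 3: "pair_action \<Omega> f (pair_action \<Omega> g z) \<in> ?oH (pair_action \<Omega> g z)"
        by (rule CD[OF f gz])
      show ?thesis
        unfolding 1 by (rule A.orbit_trans[OF z gz img[OF B(1) gz] 2 3])
    qed
    with compose_Bij[OF B] have "compose \<Omega> f g \<in> ?C" by (rule CI)
    then show ?thesis unfolding BijGroup_def using B by simp
  qed
  have Csub: "subgroup ?C (BijGroup \<Omega>)"
    by (rule S.subgroupI) (use C1 Cinv Cmult cB in blast)+
  have orbC: "orbit ((BijGroup \<Omega>)\<lparr>carrier := ?C\<rparr>) (pair_action \<Omega>) z = ?oH z"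
    if "z \<in> \<Omega> \<times> \<Omega>" for z
  proof
    show "orbit ((BijGroup \<Omega>)\<lparr>carrier := ?C\<rparr>) (pair_action \<Omega>) z \<subseteq> ?oH z"
    proof
      fix w assume "w \<in> orbit ((BijGroup \<Omega>)\<lparr>carrier := ?C\<rparr>) (pair_action \<Omega>) z"
      then obtain f where "f \<in> ?C" "w = pair_action \<Omega> f z"
        unfolding mem_orbit_iff[of w ?C] by (rule bexE)
      then show "w \<in> ?oH z" using CD that by simp
    qed
    show "?oH z \<subseteq> orbit ((BijGroup \<Omega>)\<lparr>carrier := ?C\<rparr>) (pair_action \<Omega>) z"
    proof
      fix w assume "w \<in> ?oH z"
      then obtain h where "h \<in> H" "w = pair_action \<Omega> h z"
        unfolding mem_orbit_iff[of w H] by (rule bexE)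
      then show "w \<in> orbit ((BijGroup \<Omega>)\<lparr>carrier := ?C\<rparr>) (pair_action \<Omega>) z"
        unfolding mem_orbit_iff[of w ?C] using HC by (intro bexI[of _ h] subsetD[OF HC])
    qed
  qed
  have Ceq: "orb2 \<Omega> ?C = orb2 \<Omega> H"
    unfolding orb2_def orbits_def Setcompr_eq_image by (rule image_cong[OF refl orbC])
  have Cmax: "K \<subseteq> ?C" if K: "subgroup K (BijGroup \<Omega>)" and eq: "orb2 \<Omega> K = orb2 \<Omega> H" for K
    using orb2_eq_imp_mem_orbit[OF H K eq] subgroup.subset[OF K] by (auto simp: BijGroup_def)
  show *: "two_closure \<Omega> H = ?C"
    unfolding two_closure_def by (rule Greatest_equality) (use Csub Ceq Cmax in blast)+
  show "subgroup (two_closure \<Omega> H) (BijGroup \<Omega>)" unfolding * by (rule Csub)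
  show "orb2 \<Omega> (two_closure \<Omega> H) = orb2 \<Omega> H" unfolding * by (rule Ceq)
  show "\<And>K. subgroup K (BijGroup \<Omega>) \<Longrightarrow> orb2 \<Omega> K = orb2 \<Omega> H \<Longrightarrow> K \<subseteq> two_closure \<Omega> H"
    unfolding * by (rule Cmax)
qed

end

theory Submission
  imports Defs "HOL-Algebra.Multiplicative_Group" "HOL-Algebra.Sylow"
begin

text \<open>Let \<open>A\<close> and \<open>B\<close> be commuting permutation groups of coprime orders. If \<open>a b\<close> fixes a point,
  then so does \<open>a\<close>, which is a power of \<open>a b\<close>; so the point \<open>a x\<close> depends only on \<open>x\<close> and \<open>a b x\<close>. Hence an element \<open>f\<close>
  of the 2-closure of \<open>A B\<close>, which agrees on any two points with some \<open>a b\<close>, splits pointwise into an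
  element of the 2-closure of \<open>A\<close> and one of the 2-closure of \<open>B\<close>. These 2-closures commute again,
  since the graph of a permutation centralizing \<open>A\<close> is a union of 2-orbits of \<open>A\<close>. Splitting off the
  Sylow subgroups one by one gives the product formula and reduces nilpotency to \<open>p\<close>-groups \<open>P\<close>.
  There the lower central series shows that the 2-closure has exponent dividing \<open>\<bar>P\<bar>\<^sup>c\<close>, where \<open>c\<close> is
  the nilpotency class of \<open>P\<close>. So it is a \<open>p\<close>-group, and hence nilpotent.\<close>

subsection \<open>The lower central series\<close>

lemma (in group) inv_mult_cancel:
  assumes "g \<in> carrier G" "x \<in> carrier G"
  shows "inv g \<otimes> (g \<otimes> x) = x" "g \<otimes> (inv g \<otimes> x) = x"
  using assms by (simp_all flip: m_assoc)

text \<open>Clears the inverses: commutator identities are then checked as rules for exchanging two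
  factors at the cost of \<open>c\<close>.\<close>

lemma (in group) commutator_eq_iff:
  assumes "x \<in> carrier G" "y \<in> carrier G" "c \<in> carrier G"
  shows "x \<otimes> y \<otimes> inv x \<otimes> inv y = c \<longleftrightarrow> x \<otimes> y = c \<otimes> (y \<otimes> x)"
proof
  assume "x \<otimes> y \<otimes> inv x \<otimes> inv y = c"
  then have "c \<otimes> (y \<otimes> x) = x \<otimes> y \<otimes> inv x \<otimes> inv y \<otimes> (y \<otimes> x)" by simp
  also have "\<dots> = x \<otimes> y"
    using assms by (simp add: m_assoc inv_mult_cancel)
  finally show "x \<otimes> y = c \<otimes> (y \<otimes> x)" by simp
next
  assume "x \<otimes> y = c \<otimes> (y \<otimes> x)"
  then show "x \<otimes> y \<otimes> inv x \<otimes> inv y = c"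
    using assms by (simp add: m_assoc)
qed

lemma (in group) inv_commutator:
  assumes "x \<in> carrier G" "y \<in> carrier G"
  shows "inv (x \<otimes> y \<otimes> inv x \<otimes> inv y) = y \<otimes> x \<otimes> inv y \<otimes> inv x"
  using assms by (simp add: inv_mult_group m_assoc)

text \<open>Conjugation takes the commutator of \<open>x\<close> and \<open>y\<close> to the
  commutator of their conjugates, so the generating set of each term is invariant once the previous
  term is normal.\<close>

lemma (in group) lower_central_normal: "lower_central G n \<lhd> G"
proof (induction n)
  case 0
  show ?case by (simp add: normal_inv_iff subgroup_self)
next
  case (Suc n)
  then interpret N: normal "lower_central G n" G .
  show ?case
    unfolding lower_central.simps
  proof (rule normal_generateI)
    fix h g assume h: "h \<in> (\<Union>x \<in> lower_central G n. \<Union>y \<in> carrier G. {x \<otimes> y \<otimes> inv x \<otimes> inv y})"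
      and g: "g \<in> carrier G"
    then obtain x y where xy: "x \<in> lower_central G n" "y \<in> carrier G"
      and h: "h = x \<otimes> y \<otimes> inv x \<otimes> inv y" by blast
    have x: "x \<in> carrier G" using xy(1) by (rule N.mem_carrier)
    have "g \<otimes> h \<otimes> inv g = (g \<otimes> x \<otimes> inv g) \<otimes> (g \<otimes> y \<otimes> inv g)
        \<otimes> inv (g \<otimes> x \<otimes> inv g) \<otimes> inv (g \<otimes> y \<otimes> inv g)"
      using g x xy(2) unfolding h by (simp add: m_assoc inv_mult_group inv_mult_cancel)
    moreover have "g \<otimes> x \<otimes> inv g \<in> lower_central G n" using N.inv_op_closed2[OF g xy(1)] .
    ultimately show "g \<otimes> h \<otimes> inv g \<in>
        (\<Union>x \<in> lower_central G n. \<Union>y \<in> carrier G. {x \<otimes> y \<otimes> inv x \<otimes> inv y})"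
      using g xy(2) by (intro UN_I[of "g \<otimes> x \<otimes> inv g"] UN_I[of "g \<otimes> y \<otimes> inv g"]) simp_all
  next
    show "(\<Union>x \<in> lower_central G n. \<Union>y \<in> carrier G. {x \<otimes> y \<otimes> inv x \<otimes> inv y}) \<subseteq> carrier G"
      using N.mem_carrier by (intro UN_least) simp
  qed
qed

lemma (in group) commutator_in_lower_central_Suc:
  assumes "x \<in> lower_central G n" "y \<in> carrier G"
  shows "x \<otimes> y \<otimes> inv x \<otimes> inv y \<in> lower_central G (Suc n)"
  unfolding lower_central.simps using assms by (intro generate.incl) blast

lemma (in group) lower_central_Suc_subset:
  assumes "subgroup H G"
    and "\<And>x y. x \<in> lower_central G n \<Longrightarrow> y \<in> carrier G \<Longrightarrow> x \<otimes> y \<otimes> inv x \<otimes> inv y \<in> H"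
  shows "lower_central G (Suc n) \<subseteq> H"
  unfolding lower_central.simps using assms by (intro generate_subgroup_incl) blast+

text \<open>Commutators with the identity are trivial. This allows the series of two nilpotent
  groups to be evaluated at a common index.\<close>

lemma (in group) lower_central_trivial_mono:
  assumes "lower_central G m = {\<one>}" "m \<le> n"
  shows "lower_central G n = {\<one>}"
  using assms(2,1)
proof (induction n rule: dec_induct)
  case (step n)
  have "lower_central G (Suc n) \<subseteq> {\<one>}"
    using step by (intro lower_central_Suc_subset triv_subgroup) auto
  moreover have "\<one> \<in> lower_central G (Suc n)"
    by (simp add: generate.one)
  ultimately show ?case by blast
qed

lemma (in normal) rcos_eq_iff:
  assumes "a \<in> carrier G" "b \<in> carrier G"
  shows "H #> a = H #> b \<longleftrightarrow> a \<otimes> inv b \<in> H"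
proof -
  have "H #> a = H #> b \<longleftrightarrow> a \<in> H #> b"
    using assms rcos_self repr_independence is_subgroup by metis
  then show ?thesis using rcos_module[OF is_group assms(2,1)] by simp
qed

section \<open>Elements of coprime orders in nilpotent groups\<close>

lemma (in group) coprime_pow_eq_one:
  assumes "x \<in> carrier G" "x [^] (m::nat) = \<one>" "x [^] (n::nat) = \<one>" "coprime m n"
  shows "x = \<one>"
proof -
  have "ord x dvd m" "ord x dvd n" using assms pow_eq_id by blast+
  then show ?thesis using assms ord_eq_1 coprime_common_divisor_nat by blast
qed

text \<open>Since \<open>c\<close> commutes with \<open>x\<close> and \<open>y\<close>, exchanging
  \<open>x^k\<close> and \<open>y\<close> costs \<open>c^k\<close>, and so does exchanging
  \<open>x\<close> and \<open>y^k\<close>. The exponents \<open>m\<close> and \<open>n\<close> give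
  \<open>c^m = 1 = c^n\<close>, whence \<open>c = 1\<close>.\<close>

lemma (in group) coprime_commute_of_central_commutator:
  assumes c: "x \<in> carrier G" "y \<in> carrier G" "c \<in> carrier G"
    and xy: "x \<otimes> y = c \<otimes> (y \<otimes> x)"
    and cx: "c \<otimes> x = x \<otimes> c" and cy: "c \<otimes> y = y \<otimes> c"
    and "x [^] (m::nat) = \<one>" "y [^] (n::nat) = \<one>" "coprime m n"
  shows "x \<otimes> y = y \<otimes> x"
proof -
  have 1: "x [^] k \<otimes> y = c [^] k \<otimes> (y \<otimes> x [^] k)" for k :: nat
  proof (induction k)
    case (Suc k)
    have "x [^] Suc k \<otimes> y = x [^] k \<otimes> (x \<otimes> y)" using c by (simp add: m_assoc)
    also have "\<dots> = x [^] k \<otimes> (c \<otimes> (y \<otimes> x))" by (simp only: xy)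
    also have "\<dots> = c \<otimes> (x [^] k \<otimes> y) \<otimes> x"
      using c group_commutes_pow[OF cx[symmetric], of k] by (simp flip: m_assoc)
    also have "\<dots> = c [^] Suc k \<otimes> (y \<otimes> x [^] Suc k)"
      using c unfolding Suc.IH nat_pow_Suc2[OF c(3)] by (simp add: m_assoc)
    finally show ?case .
  qed (use c in simp)
  have 2: "x \<otimes> y [^] k = c [^] k \<otimes> (y [^] k \<otimes> x)" for k :: nat
  proof (induction k)
    case (Suc k)
    have "x \<otimes> y [^] Suc k = (x \<otimes> y [^] k) \<otimes> y" using c by (simp add: m_assoc)
    also have "\<dots> = c [^] k \<otimes> (y [^] k \<otimes> (x \<otimes> y))" unfolding Suc.IH using c by (simp add: m_assoc)
    also have "\<dots> = c [^] k \<otimes> (y [^] k \<otimes> (c \<otimes> (y \<otimes> x)))" by (simp only: xy)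
    also have "\<dots> = c [^] k \<otimes> (c \<otimes> y [^] k) \<otimes> (y \<otimes> x)"
      using c group_commutes_pow[OF cy[symmetric], of k] by (simp flip: m_assoc)
    also have "\<dots> = c [^] Suc k \<otimes> (y [^] Suc k \<otimes> x)"
      using c by (simp add: m_assoc)
    finally show ?case .
  qed (use c in simp)
  have "c [^] m = \<one>" using 1[of m] c assms(7) by (simp add: r_cancel_one')
  moreover have "c [^] n = \<one>" using 2[of n] c assms(8) by (simp add: r_cancel_one')
  ultimately have "c = \<one>" using coprime_pow_eq_one c(3) assms(9) by blast
  then show ?thesis using xy c by simp
qed

text \<open>The commutator \<open>c\<close> of \<open>x\<close> and \<open>y\<close> descends the
  lower central series: if it lies in the \<open>i\<close>-th term, it is central modulo the next
  one, so \<open>x\<close> and \<open>y\<close> commute modulo that term by the preceding lemma, and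
  \<open>c\<close> lies in it.\<close>

lemma (in group) nilpotent_coprime_commute:
  assumes nil: "nilpotent_group G"
    and c: "x \<in> carrier G" "y \<in> carrier G"
    and pw: "x [^] (m::nat) = \<one>" "y [^] (n::nat) = \<one>" "coprime m n"
  shows "x \<otimes> y = y \<otimes> x"
proof -
  define c where "c = x \<otimes> y \<otimes> inv x \<otimes> inv y"
  have cc: "c \<in> carrier G" using assms(2,3) by (simp add: c_def)
  have xy: "x \<otimes> y = c \<otimes> (y \<otimes> x)"
    using commutator_eq_iff assms(2,3) cc c_def by blast
  have "c \<in> lower_central G i" for i
  proof (induction i)
    case (Suc i)
    define N where "N = lower_central G (Suc i)"
    interpret N: normal N G unfolding N_def by (rule lower_central_normal)
    interpret Q: group "G Mod N" by (rule N.factorgroup_is_group)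
    have car: "N #> a \<in> carrier (G Mod N)" if "a \<in> carrier G" for a
      using that by (auto simp: carrier_FactGroup)
    have comm: "N #> (c \<otimes> z) = N #> (z \<otimes> c)" if "z \<in> carrier G" for z
    proof -
      have "c \<otimes> z \<otimes> inv (z \<otimes> c) = c \<otimes> z \<otimes> inv c \<otimes> inv z"
        using that cc by (simp add: inv_mult_group m_assoc)
      also have "\<dots> \<in> N" unfolding N_def by (rule commutator_in_lower_central_Suc[OF Suc that])
      finally show ?thesis using that cc N.rcos_eq_iff by simp
    qed
    have "(N #> x) \<otimes>\<^bsub>G Mod N\<^esub> (N #> y) = (N #> y) \<otimes>\<^bsub>G Mod N\<^esub> (N #> x)"
    proof (rule Q.coprime_commute_of_central_commutator[where c="N #> c" and m=m and n=n])
      show "(N #> x) [^]\<^bsub>G Mod N\<^esub> m = \<one>\<^bsub>G Mod N\<^esub>"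
        using pw(1) assms(2) N.subset by (simp add: N.FactGroup_pow)
      show "(N #> y) [^]\<^bsub>G Mod N\<^esub> n = \<one>\<^bsub>G Mod N\<^esub>"
        using pw(2) assms(3) N.subset by (simp add: N.FactGroup_pow)
    qed (use assms(2,3) cc car comm pw(3) xy in \<open>simp_all add: N.rcos_sum\<close>)
    then have "N #> (x \<otimes> y) = N #> (y \<otimes> x)"
      using assms(2,3) by (simp add: N.rcos_sum)
    then have "x \<otimes> y \<otimes> inv (y \<otimes> x) \<in> N"
      using assms(2,3) N.rcos_eq_iff by simp
    moreover have "x \<otimes> y \<otimes> inv (y \<otimes> x) = c"
      using assms(2,3) by (simp add: c_def inv_mult_group m_assoc)
    ultimately show ?case by (simp only: N_def)
  qed (use cc in simp)
  then have "c = \<one>" using nil by (auto simp: nilpotent_group_def)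
  then show ?thesis using xy assms(2,3) by simp
qed

subsection \<open>Commuting products and Sylow subgroups\<close>

lemma subgroups_product_simps [simp]:
  "subgroups_product G [] = {\<one>\<^bsub>G\<^esub>}"
  "subgroups_product G (H # Hs) = H <#>\<^bsub>G\<^esub> subgroups_product G Hs"
  by (simp_all add: subgroups_product_def)

text \<open>The product uses only the multiplication and the identity. Results about subgroups of a
  permutation group thus carry over to products formed in the symmetric group.\<close>

lemma subgroups_product_consistent [simp]:
  "subgroups_product (G\<lparr>carrier := H\<rparr>) Ks = subgroups_product G Ks"
  by (induction Ks) simp_all

text \<open>Lagrange's theorem within \<open>H\<close>; for infinite \<open>H\<close> the exponent
  is 0. It turns coprime orders of subgroups into coprime exponents of their elements.\<close>

lemma (in group) pow_card_subgroup:
  assumes "subgroup H G" "h \<in> H"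
  shows "h [^] card H = \<one>"
proof -
  interpret H: group "G\<lparr>carrier := H\<rparr>" by (rule subgroup_imp_group[OF assms(1)])
  show ?thesis
    using H.pow_order_eq_1[of h] assms(2) by (simp add: order_def flip: nat_pow_consistent)
qed

lemma (in group) mult_commuting:
  assumes "a \<in> carrier G" "a' \<in> carrier G" "b \<in> carrier G" "b' \<in> carrier G" "b \<otimes> a' = a' \<otimes> b"
  shows "(a \<otimes> b) \<otimes> (a' \<otimes> b') = (a \<otimes> a') \<otimes> (b \<otimes> b')"
proof -
  have "(a \<otimes> b) \<otimes> (a' \<otimes> b') = a \<otimes> (b \<otimes> a') \<otimes> b'" using assms(1-4) by (simp add: m_assoc)
  also have "\<dots> = (a \<otimes> a') \<otimes> (b \<otimes> b')" unfolding assms(5) using assms(1-4) by (simp add: m_assoc)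
  finally show ?thesis .
qed

lemma (in group) commuting_set_mult_subgroup:
  assumes A: "subgroup A G" and B: "subgroup B G"
    and comm: "\<And>a b. a \<in> A \<Longrightarrow> b \<in> B \<Longrightarrow> a \<otimes> b = b \<otimes> a"
  shows "subgroup (A <#> B) G"
proof -
  note cA = subgroup.mem_carrier[OF A] and cB = subgroup.mem_carrier[OF B]
  show ?thesis
  proof (rule subgroupI)
    show "A <#> B \<subseteq> carrier G" using cA cB by (auto simp: set_mult_def)
    show "A <#> B \<noteq> {}"
      using subgroup.one_closed[OF A] subgroup.one_closed[OF B] by (auto simp: set_mult_def)
  next
    fix x assume "x \<in> A <#> B"
    then obtain a b where ab: "a \<in> A" "b \<in> B" "x = a \<otimes> b" by (auto simp: set_mult_def)
    have "inv x = inv a \<otimes> inv b"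
      using ab comm[OF ab(1,2)] cA cB by (simp add: inv_mult_group)
    then show "inv x \<in> A <#> B"
      using ab subgroup.m_inv_closed[OF A] subgroup.m_inv_closed[OF B] by (auto simp: set_mult_def)
  next
    fix x y assume "x \<in> A <#> B" "y \<in> A <#> B"
    then obtain a b a' b' where ab: "a \<in> A" "b \<in> B" "x = a \<otimes> b" "a' \<in> A" "b' \<in> B" "y = a' \<otimes> b'"
      by (auto simp: set_mult_def)
    then have "x \<otimes> y = (a \<otimes> a') \<otimes> (b \<otimes> b')"
      using ab cA cB comm[OF ab(4,2)] by (simp add: mult_commuting)
    then show "x \<otimes> y \<in> A <#> B"
      using subgroup.m_closed[OF A ab(1,4)] subgroup.m_closed[OF B ab(2,5)]
      unfolding set_mult_def by blast
  qed
qed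

text \<open>An element of both subgroups is annihilated by two coprime exponents, so
  \<open>A\<close> and \<open>B\<close> meet trivially and the multiplication map on
  \<open>A \<times> B\<close> is injective.\<close>

lemma (in group) card_set_mult_coprime:
  assumes A: "subgroup A G" and B: "subgroup B G" and co: "coprime (card A) (card B)"
  shows "card (A <#> B) = card A * card B"
proof -
  interpret D: group_disjoint_sum G A B
    using A B by (simp add: group_disjoint_sum_def)
  have "A \<inter> B \<subseteq> {\<one>}"
    using coprime_pow_eq_one[OF _ _ _ co] pow_card_subgroup[OF A] pow_card_subgroup[OF B]
      subgroup.mem_carrier[OF A] by blast
  then have "inj_on (\<lambda>(a, b). a \<otimes> b) (A \<times> B)"
    unfolding D.cancel inj_on_def by fast
  moreover have "A <#> B = (\<lambda>(a, b). a \<otimes> b) ` (A \<times> B)"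
    by (auto simp: set_mult_def)
  ultimately show ?thesis
    by (simp add: card_image card_cartesian_product)
qed

text \<open>As the factors commute, the commutator of \<open>a b\<close> and \<open>a' b'\<close> is
  the commutator of \<open>a\<close> and \<open>a'\<close> times that of \<open>b\<close> and
  \<open>b'\<close>.\<close>

lemma (in group) commuting_lower_central:
  assumes A: "subgroup A G" and B: "subgroup B G"
    and comm: "\<And>a b. a \<in> A \<Longrightarrow> b \<in> B \<Longrightarrow> a \<otimes> b = b \<otimes> a"
  shows "lower_central (G\<lparr>carrier := A <#> B\<rparr>) n \<subseteq>
    lower_central (G\<lparr>carrier := A\<rparr>) n <#> lower_central (G\<lparr>carrier := B\<rparr>) n"
proof (induction n)
  case (Suc n)
  let ?A = "G\<lparr>carrier := A\<rparr>" and ?B = "G\<lparr>carrier := B\<rparr>" and ?C = "G\<lparr>carrier := A <#> B\<rparr>"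
  have C: "subgroup (A <#> B) G" by (rule commuting_set_mult_subgroup[OF A B comm])
  interpret A: group ?A by (rule subgroup_imp_group[OF A])
  interpret B: group ?B by (rule subgroup_imp_group[OF B])
  interpret C: group ?C by (rule subgroup_imp_group[OF C])
  note cA = subgroup.mem_carrier[OF A] and cB = subgroup.mem_carrier[OF B]
  have LA: "subgroup (lower_central ?A k) ?A" "lower_central ?A k \<subseteq> A" for k
    using normal_imp_subgroup[OF A.lower_central_normal, of k]
      subgroup.subset[OF normal_imp_subgroup[OF A.lower_central_normal, of k]] by simp_all
  have LB: "subgroup (lower_central ?B k) ?B" "lower_central ?B k \<subseteq> B" for k
    using normal_imp_subgroup[OF B.lower_central_normal, of k]
      subgroup.subset[OF normal_imp_subgroup[OF B.lower_central_normal, of k]] by simp_all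
  let ?L = "lower_central ?A (Suc n)" and ?M = "lower_central ?B (Suc n)"
  have "subgroup (?L <#> ?M) ?C"
  proof (rule subgroup_incl)
    show "subgroup (?L <#> ?M) G"
      using LA(2) LB(2) comm
      by (intro commuting_set_mult_subgroup incl_subgroup[OF A LA(1)] incl_subgroup[OF B LB(1)]) blast
    show "?L <#> ?M \<subseteq> A <#> B" by (intro mono_set_mult LA LB)
  qed (rule C)
  moreover have "x \<otimes>\<^bsub>?C\<^esub> y \<otimes>\<^bsub>?C\<^esub> inv\<^bsub>?C\<^esub> x \<otimes>\<^bsub>?C\<^esub> inv\<^bsub>?C\<^esub> y \<in> ?L <#> ?M"
    if x: "x \<in> lower_central ?C n" and y: "y \<in> carrier ?C" for x y
  proof -
    obtain a b where a: "a \<in> lower_central ?A n" and b: "b \<in> lower_central ?B n" and xab: "x = a \<otimes> b"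
      using x Suc by (auto simp: set_mult_def)
    obtain a' b' where a': "a' \<in> A" and b': "b' \<in> B" and yab: "y = a' \<otimes> b'"
      using y by (auto simp: set_mult_def)
    have aA: "a \<in> A" and bB: "b \<in> B" using a b LA(2) LB(2) by blast+
    define c d where "c = a \<otimes> a' \<otimes> inv a \<otimes> inv a'" and "d = b \<otimes> b' \<otimes> inv b \<otimes> inv b'"
    have cL: "c \<in> ?L"
      using A.commutator_in_lower_central_Suc[OF a, of a'] a' aA m_inv_consistent[OF A]
      by (simp add: c_def del: lower_central.simps)
    have dM: "d \<in> ?M"
      using B.commutator_in_lower_central_Suc[OF b, of b'] b' bB m_inv_consistent[OF B]
      by (simp add: d_def del: lower_central.simps)
    have cA': "c \<in> A" and dB: "d \<in> B" using cL dM LA(2) LB(2) by blast+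
    note car = aA[THEN cA] bB[THEN cB] a'[THEN cA] b'[THEN cB] cA'[THEN cA] dB[THEN cB]
    have xC: "x \<in> A <#> B" "y \<in> A <#> B" using aA bB a' b' xab yab by (auto simp: set_mult_def)
    have 1: "a \<otimes> a' = c \<otimes> (a' \<otimes> a)" "b \<otimes> b' = d \<otimes> (b' \<otimes> b)"
      using car commutator_eq_iff c_def d_def by blast+
    \<comment> \<open>The aim is \<open>x y = (c d) (y x)\<close>: the factors from \<open>A\<close>
      are collected on the left, both pairs are exchanged at the cost of \<open>c\<close> and
      \<open>d\<close>, and the factors are put back in place.\<close>
    have "x \<otimes> y = (a \<otimes> a') \<otimes> (b \<otimes> b')"
      unfolding xab yab using car comm[OF a' bB] by (intro mult_commuting) auto
    also have "\<dots> = (c \<otimes> (a' \<otimes> a)) \<otimes> (d \<otimes> (b' \<otimes> b))" by (simp only: 1)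
    also have "\<dots> = (c \<otimes> d) \<otimes> ((a' \<otimes> a) \<otimes> (b' \<otimes> b))"
      using car comm[OF subgroup.m_closed[OF A a' aA] dB] by (intro mult_commuting) auto
    also have "(a' \<otimes> a) \<otimes> (b' \<otimes> b) = y \<otimes> x"
      unfolding xab yab using car comm[OF aA b'] by (intro mult_commuting[symmetric]) auto
    finally have "x \<otimes> y \<otimes> inv x \<otimes> inv y = c \<otimes> d"
      using car by (subst commutator_eq_iff) (auto simp: xab yab)
    then show ?thesis
      using cL dM xC m_inv_consistent[OF C]
      by (auto simp: set_mult_def simp del: lower_central.simps)
  qed
  ultimately show ?case
    by (rule C.lower_central_Suc_subset)
qed simp

lemma (in group) nilpotent_commuting_set_mult:
  assumes A: "subgroup A G" and B: "subgroup B G"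
    and comm: "\<And>a b. a \<in> A \<Longrightarrow> b \<in> B \<Longrightarrow> a \<otimes> b = b \<otimes> a"
    and nA: "nilpotent_group (G\<lparr>carrier := A\<rparr>)" and nB: "nilpotent_group (G\<lparr>carrier := B\<rparr>)"
  shows "nilpotent_group (G\<lparr>carrier := A <#> B\<rparr>)"
proof -
  have C: "subgroup (A <#> B) G" by (rule commuting_set_mult_subgroup[OF A B comm])
  interpret A: group "G\<lparr>carrier := A\<rparr>" by (rule subgroup_imp_group[OF A])
  interpret B: group "G\<lparr>carrier := B\<rparr>" by (rule subgroup_imp_group[OF B])
  interpret C: group "G\<lparr>carrier := A <#> B\<rparr>" by (rule subgroup_imp_group[OF C])
  obtain m n where m: "lower_central (G\<lparr>carrier := A\<rparr>) m = {\<one>}"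
    and n: "lower_central (G\<lparr>carrier := B\<rparr>) n = {\<one>}"
    using nA nB by (auto simp: nilpotent_group_def)
  have "lower_central (G\<lparr>carrier := A <#> B\<rparr>) (max m n) \<subseteq> {\<one>}"
    using commuting_lower_central[OF A B comm, of "max m n"]
      A.lower_central_trivial_mono[of m "max m n"] B.lower_central_trivial_mono[of n "max m n"] m n
    by (simp add: set_mult_def)
  moreover have "\<one> \<in> lower_central (G\<lparr>carrier := A <#> B\<rparr>) (max m n)"
    using subgroup.one_closed[OF normal_imp_subgroup[OF C.lower_central_normal]] by simp
  ultimately show ?thesis
    using C.group_axioms by (auto simp: nilpotent_group_def)
qed

text \<open>Elements of subgroups of coprime orders commute in a nilpotent group, so each factor
  commutes with the product of the later ones. The third part is what allows a further factor to be
  split off.\<close>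

lemma (in group) nilpotent_subgroups_product:
  assumes "nilpotent_group G"
    and "\<And>H. H \<in> set Hs \<Longrightarrow> subgroup H G"
    and "sorted_wrt (\<lambda>H K. coprime (card H) (card K)) Hs"
  shows "subgroup (subgroups_product G Hs) G"
    and "card (subgroups_product G Hs) = prod_list (map card Hs)"
    and "\<And>n::nat. \<forall>K \<in> set Hs. coprime n (card K) \<Longrightarrow>
      coprime n (card (subgroups_product G Hs))"
proof -
  have co: "coprime n (prod_list (map card Hs))" if "\<forall>K \<in> set Hs. coprime n (card K)" for n :: nat and Hs
    using that by (induction Hs) auto
  have *: "subgroup (subgroups_product G Hs) G \<and>
      card (subgroups_product G Hs) = prod_list (map card Hs)"
    using assms(2,3)
  proof (induction Hs)
    case Nil
    then show ?case by (simp add: triv_subgroup)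
  next
    case (Cons H Hs)
    let ?K = "subgroups_product G Hs"
    have H: "subgroup H G" and K: "subgroup ?K G" and cK: "card ?K = prod_list (map card Hs)"
      using Cons by simp_all
    have c: "coprime (card H) (card ?K)" unfolding cK using Cons.prems(2) by (intro co) simp
    have "h \<otimes> k = k \<otimes> h" if "h \<in> H" "k \<in> ?K" for h k
      using nilpotent_coprime_commute[OF assms(1) _ _ _ _ c] pow_card_subgroup[OF H]
        pow_card_subgroup[OF K] subgroup.mem_carrier[OF H] subgroup.mem_carrier[OF K] that by blast
    then have "subgroup (H <#> ?K) G" by (rule commuting_set_mult_subgroup[OF H K])
    then show ?case
      using card_set_mult_coprime[OF H K c] cK by simp
  qed
  then show "subgroup (subgroups_product G Hs) G"
    "card (subgroups_product G Hs) = prod_list (map card Hs)" by auto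
  show "coprime n (card (subgroups_product G Hs))"
    if "\<forall>K \<in> set Hs. coprime n (card K)" for n :: nat
    using co * that by simp
qed

section \<open>Sylow subgroups of nilpotent groups\<close>

lemma (in group) exists_sylow_subgroup:
  assumes "finite (carrier G)" "prime p"
  shows "\<exists>P. subgroup P G \<and> card P = p ^ multiplicity p (order G)"
proof -
  obtain m where "order G = p ^ multiplicity p (order G) * m" using multiplicity_dvd dvdE by metis
  then show ?thesis using sylow_thm[OF assms(2) group_axioms _ assms(1)] by blast
qed

text \<open>Let \<open>B\<close> be the product of Sylow subgroups for the other primes. Counting
  shows that \<open>P B\<close> is all of \<open>G\<close>. If \<open>u b\<close> lies in
  \<open>P'\<close>, raising it to the power \<open>card P\<close> annihilates \<open>u b\<close>
  and \<open>u\<close>, hence \<open>b\<close>; but this exponent is coprime to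
  \<open>card B\<close>, so \<open>b = 1\<close>.\<close>

lemma (in group) nilpotent_sylow_unique:
  assumes nil: "nilpotent_group G" and fin: "finite (carrier G)"
    and p: "prime p" "p dvd order G"
    and P: "subgroup P G" "card P = p ^ multiplicity p (order G)"
    and P': "subgroup P' G" "card P' = p ^ multiplicity p (order G)"
  shows "P = P'"
proof -
  let ?n = "order G"
  have n: "?n > 0" using fin by (simp add: order_gt_0_iff_finite)
  have "\<forall>q\<in>{q. prime q}. \<exists>P. subgroup P G \<and> card P = q ^ multiplicity q ?n"
    using exists_sylow_subgroup[OF fin] by blast
  from bchoice[OF this] obtain Q where Q: "\<And>q. prime q \<Longrightarrow> subgroup (Q q) G"
    "\<And>q. prime q \<Longrightarrow> card (Q q) = q ^ multiplicity q ?n" by blast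
  let ?F = "prime_factors ?n - {p}"
  \<comment> \<open>The increasing order makes any two listed primes distinct, which gives pairwise
    coprimality in the form of \<open>sorted_wrt\<close>.\<close>
  define qs where "qs = sorted_list_of_set ?F"
  have qs: "set qs = ?F" "distinct qs" "sorted_wrt (<) qs" by (simp_all add: qs_def)
  let ?B = "subgroups_product G (map Q qs)"
  have co: "coprime (card (Q q)) (card (Q r))" if "prime q" "prime r" "q \<noteq> r" for q r
    using that Q(2) primes_coprime[of q r] by simp
  have srt: "sorted_wrt (\<lambda>H K. coprime (card H) (card K)) (map Q qs)"
    unfolding sorted_wrt_map
  proof (rule sorted_wrt_mono_rel[OF _ qs(3)])
    fix q r assume "q \<in> set qs" "r \<in> set qs" "q < r"
    then show "coprime (card (Q q)) (card (Q r))" unfolding qs(1) by (intro co) auto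
  qed
  note np = nilpotent_subgroups_product[OF nil _ srt]
  have B: "subgroup ?B G" using Q(1) qs(1) by (intro np(1)) auto
  have cB: "card ?B = (\<Prod>q\<in>?F. q ^ multiplicity q ?n)"
  proof -
    have "card ?B = prod_list (map card (map Q qs))" using Q(1) qs(1) by (intro np(2)) auto
    also have "\<dots> = (\<Prod>q\<in>?F. card (Q q))"
      using qs by (simp add: prod.distinct_set_conv_list[symmetric] o_def)
    also have "\<dots> = (\<Prod>q\<in>?F. q ^ multiplicity q ?n)"
      using Q(2) by (intro prod.cong) auto
    finally show ?thesis .
  qed
  have "?n = (\<Prod>q\<in>prime_factors ?n. q ^ multiplicity q ?n)"
    using n prime_factorization_nat by blast
  also have "\<dots> = card P * card ?B"
    using p n cB P(2) by (subst prod.remove[of _ p]) (auto simp: prime_factors_dvd)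
  finally have nPB: "?n = card P * card ?B" .
  have cop: "coprime (p ^ multiplicity p ?n) (card ?B)"
    unfolding cB using p(1) by (intro prod_coprime_right) (auto intro!: primes_coprime)
  have comm: "a \<otimes> b = b \<otimes> a" if "a \<in> P" "b \<in> ?B" for a b
    using nilpotent_coprime_commute[OF nil _ _ _ _ cop] pow_card_subgroup[OF P(1), unfolded P(2)]
      pow_card_subgroup[OF B] subgroup.mem_carrier[OF P(1)] subgroup.mem_carrier[OF B] that by blast
  have "card (P <#> ?B) = ?n"
    unfolding nPB by (rule card_set_mult_coprime[OF P(1) B]) (simp only: P(2) cop)
  then have PB: "P <#> ?B = carrier G"
    using subgroup.subset[OF commuting_set_mult_subgroup[OF P(1) B comm]] fin
    by (simp add: card_subset_eq order_def)
  have "P' \<subseteq> P"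
  proof
    fix x assume x: "x \<in> P'"
    then have "x \<in> P <#> ?B" using subgroup.mem_carrier[OF P'(1)] PB by blast
    then obtain u b where ub: "u \<in> P" "b \<in> ?B" "x = u \<otimes> b"
      unfolding set_mult_def by blast
    note c = subgroup.mem_carrier[OF P(1) ub(1)] subgroup.mem_carrier[OF B ub(2)]
    have "\<one> = x [^] (p ^ multiplicity p ?n)" using pow_card_subgroup[OF P'(1) x] P'(2) by simp
    also have "\<dots> = u [^] (p ^ multiplicity p ?n) \<otimes> b [^] (p ^ multiplicity p ?n)"
      unfolding ub(3) using pow_mult_distrib[OF comm[OF ub(1,2)] c] .
    also have "\<dots> = b [^] (p ^ multiplicity p ?n)"
      using pow_card_subgroup[OF P(1) ub(1)] P(2) c by simp
    finally have "b = \<one>"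
      using coprime_pow_eq_one[OF c(2) _ _ cop] pow_card_subgroup[OF B ub(2)] by simp
    then show "x \<in> P" using ub c by simp
  qed
  moreover have "finite P" using subgroup.subset[OF P(1)] fin finite_subset by blast
  ultimately show ?thesis using P(2) P'(2) by (metis card_subset_eq)
qed

text \<open>By uniqueness there is exactly one Sylow subgroup \<open>Q q\<close> for each prime
  divisor \<open>q\<close>, so the orders are pairwise coprime and multiply up to the order of
  \<open>G\<close>.\<close>

lemma (in group) nilpotent_product_sylow_subgroups:
  assumes nil: "nilpotent_group G" and fin: "finite (carrier G)"
    and Ps: "distinct Ps" "set Ps = sylow_subgroups G"
  shows "sorted_wrt (\<lambda>H K. coprime (card H) (card K)) Ps"
    and "subgroups_product G Ps = carrier G"
proof -
  let ?n = "order G"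
  let ?F = "prime_factors ?n"
  have n: "?n > 0" using fin by (simp add: order_gt_0_iff_finite)
  have "\<forall>q\<in>{q. prime q}. \<exists>P. subgroup P G \<and> card P = q ^ multiplicity q ?n"
    using exists_sylow_subgroup[OF fin] by blast
  from bchoice[OF this] obtain Q where Q: "\<And>q. prime q \<Longrightarrow> subgroup (Q q) G"
    "\<And>q. prime q \<Longrightarrow> card (Q q) = q ^ multiplicity q ?n" by blast
  have syl: "sylow_subgroups G = Q ` ?F"
  proof
    show "sylow_subgroups G \<subseteq> Q ` ?F"
    proof
      fix P assume "P \<in> sylow_subgroups G"
      then obtain p where P: "subgroup P G" "prime p" "p dvd ?n" "card P = p ^ multiplicity p ?n"
        by (auto simp: sylow_subgroups_def)
      then have "P = Q p" using nilpotent_sylow_unique[OF nil fin P(2,3,1,4)] Q by blast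
      then show "P \<in> Q ` ?F" using P n by (auto simp: prime_factors_dvd)
    qed
    show "Q ` ?F \<subseteq> sylow_subgroups G"
      using Q by (auto simp: sylow_subgroups_def prime_factors_dvd)
  qed
  have co: "coprime (card (Q q)) (card (Q r))" if "prime q" "prime r" "q \<noteq> r" for q r
    using that Q(2) primes_coprime[of q r] by simp
  have "coprime (card H) (card K)" if HK: "H \<in> set Ps" "K \<in> set Ps" "H \<noteq> K" for H K
  proof -
    obtain q r where "H = Q q" "K = Q r" "q \<in> ?F" "r \<in> ?F"
      using HK(1,2) unfolding Ps(2) syl by blast
    moreover from this have "q \<noteq> r" using HK(3) by blast
    ultimately show ?thesis using co by (simp add: in_prime_factors_imp_prime)
  qed
  then show srt: "sorted_wrt (\<lambda>H K. coprime (card H) (card K)) Ps"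
    using Ps(1) by (auto simp: sorted_wrt_iff_nth_less nth_eq_iff_index_eq)
  have sub: "\<And>H. H \<in> set Ps \<Longrightarrow> subgroup H G"
    unfolding Ps(2) by (simp add: sylow_subgroups_def)
  note np = nilpotent_subgroups_product[OF nil sub srt]
  have inj: "inj_on Q ?F"
  proof (rule inj_onI)
    fix q r assume *: "q \<in> ?F" "r \<in> ?F" "Q q = Q r"
    \<comment> \<open>An order other than 1 is not coprime to itself, so different primes cannot
      share a subgroup.\<close>
    then have "card (Q q) \<noteq> 1"
      using Q(2) by (auto simp: prime_factors_multiplicity)
    then show "q = r" using co[of q r] * by (cases "q = r") (simp_all add: in_prime_factors_imp_prime)
  qed
  have "card (subgroups_product G Ps) = (\<Prod>P\<in>set Ps. card P)"
    using np(2) Ps(1) by (simp add: prod.distinct_set_conv_list)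
  also have "\<dots> = (\<Prod>q\<in>?F. q ^ multiplicity q ?n)"
    unfolding Ps(2) syl using Q(2) by (subst prod.reindex[OF inj]) (auto intro!: prod.cong)
  also have "\<dots> = ?n" using n prime_factorization_nat by metis
  finally show "subgroups_product G Ps = carrier G"
    using subgroup.subset[OF np(1)] fin by (simp add: card_subset_eq order_def)
qed

subsection \<open>Finite \<open>p\<close>-groups\<close>

text \<open>The class equation: conjugacy classes have sizes dividing \<open>p^k\<close>. If only
  the identity were central, all other classes would have size divisible by \<open>p\<close>, so
  that \<open>p\<close> would divide \<open>p^k - 1\<close>.\<close>

lemma (in group) p_group_nontrivial_center:
  assumes "prime p" and ord: "order G = p ^ k" and "k > 0"
  shows "\<exists>z\<in>carrier G. z \<noteq> \<one> \<and> (\<forall>y\<in>carrier G. z \<otimes> y = y \<otimes> z)"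
proof (rule ccontr)
  assume no: "\<not> ?thesis"
  have fin: "finite (carrier G)"
    using ord assms(1) by (simp add: prime_gt_0_nat flip: order_gt_0_iff_finite)
  define \<phi> where "\<phi> = (\<lambda>g. \<lambda>h \<in> carrier G. g \<otimes> h \<otimes> inv g)"
  interpret act: group_action G "carrier G" \<phi>
    unfolding \<phi>_def by (rule action_by_conjugation)
  let ?O = "orbits G (carrier G) \<phi>"
  have orb1: "orbit G \<phi> \<one> = {\<one>}"
    unfolding orbit_def \<phi>_def by (auto intro!: exI[of _ \<one>])
  have one: "{\<one>} \<in> ?O" using orb1 by (auto simp: orbits_def)
  have disj: "c1 \<inter> c2 = {}" if "c1 \<in> ?O" "c2 \<in> ?O" "c1 \<noteq> c2" for c1 c2
    using act.disjoint_union that by blast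
  have un: "\<Union> (?O - {{\<one>}}) = carrier G - {\<one>}"
    using act.orbits_coverture disj[OF one] one by blast
  have "p dvd card c" if c: "c \<in> ?O - {{\<one>}}" for c
  proof -
    obtain x where x: "x \<in> carrier G" "c = orbit G \<phi> x" using c by (auto simp: orbits_def)
    have "card c dvd p ^ k"
      using act.orbit_stabilizer_theorem[OF x(1)] x(2) ord by (metis dvd_triv_left)
    then obtain j where j: "card c = p ^ j" using assms(1) divides_primepow_nat by blast
    have "card c \<noteq> 1"
    proof
      assume "card c = 1"
      then have cx: "c = {x}" using act.orbit_refl[OF x(1)] x(2) by (auto simp: card_1_singleton_iff)
      have "x \<otimes> y = y \<otimes> x" if y: "y \<in> carrier G" for y
      proof -
        have "\<phi> y x \<in> c" using x y by (auto simp: orbit_def)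
        then have "y \<otimes> x \<otimes> inv y = x" using cx x by (simp add: \<phi>_def)
        then show ?thesis using x(1) y by (metis inv_solve_right' m_closed)
      qed
      moreover have "x \<noteq> \<one>" using c cx by blast
      ultimately show False using no x(1) by blast
    qed
    then show ?thesis using j by (cases j) auto
  qed
  then have "p dvd card (carrier G - {\<one>})"
    unfolding un[symmetric] using disj fin un by (intro dvd_partition) auto
  then have "p dvd p ^ k - 1" using fin ord by (simp add: order_def)
  moreover have "p dvd p ^ k" using assms(3) by simp
  ultimately have "p dvd 1"
    using assms(1) by (metis Suc_pred' dvd_add_right_iff ord order_gt_0_iff_finite fin One_nat_def
        plus_1_eq_Suc add.commute)
  then show False using assms(1) by simp
qed

lemma (in group) inv_commute:
  assumes "a \<in> carrier G" "b \<in> carrier G" "a \<otimes> b = b \<otimes> a"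
  shows "inv a \<otimes> b = b \<otimes> inv a"
proof -
  have "inv a \<otimes> b = inv a \<otimes> (b \<otimes> a) \<otimes> inv a"
    using assms(1,2) by (simp add: m_assoc)
  also have "\<dots> = b \<otimes> inv a"
    unfolding assms(3)[symmetric] using assms(1,2) by (simp add: m_assoc inv_mult_cancel)
  finally show ?thesis .
qed

lemma (in normal) commute_mod_iff:
  assumes "x \<in> carrier G" "y \<in> carrier G"
  shows "(H #> x) <#> (H #> y) = (H #> y) <#> (H #> x) \<longleftrightarrow> x \<otimes> y \<otimes> inv x \<otimes> inv y \<in> H"
proof -
  have "x \<otimes> y \<otimes> inv x \<otimes> inv y = (x \<otimes> y) \<otimes> inv (y \<otimes> x)"
    using assms by (simp add: inv_mult_group m_assoc)
  then show ?thesis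
    using assms by (simp add: rcos_sum rcos_eq_iff)
qed

text \<open>\<open>M/N\<close> is the center of \<open>G/N\<close>.\<close>

lemma (in group) central_preimage_normal:
  assumes "N \<lhd> G"
  defines "M \<equiv> {x \<in> carrier G. \<forall>y \<in> carrier G. x \<otimes> y \<otimes> inv x \<otimes> inv y \<in> N}"
  shows "M \<lhd> G" and "N \<subseteq> M"
proof -
  interpret N: normal N G by fact
  interpret Q: group "G Mod N" by (rule N.factorgroup_is_group)
  interpret h: group_hom G "G Mod N" "\<lambda>x. N #> x"
    using N.r_coset_hom_Mod N.factorgroup_is_group
    by (simp add: group_hom_def group_hom_axioms_def)
  have M: "x \<in> M \<longleftrightarrow> x \<in> carrier G \<and> (\<forall>y \<in> carrier G.
      (N #> x) \<otimes>\<^bsub>G Mod N\<^esub> (N #> y) = (N #> y) \<otimes>\<^bsub>G Mod N\<^esub> (N #> x))" for x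
    unfolding M_def using N.commute_mod_iff by auto
  show NM: "N \<subseteq> M"
  proof
    fix x assume x: "x \<in> N"
    have "y \<otimes> inv x \<otimes> inv y \<in> N" if "y \<in> carrier G" for y
      using x that by (intro N.inv_op_closed2) auto
    then have "x \<otimes> (y \<otimes> inv x \<otimes> inv y) \<in> N" if "y \<in> carrier G" for y
      using x that by blast
    then show "x \<in> M" using x by (simp add: M_def m_assoc)
  qed
  have sub: "subgroup M G"
  proof (rule subgroupI)
    show "M \<subseteq> carrier G" by (auto simp: M_def)
    show "M \<noteq> {}" using NM N.one_closed by blast
  next
    fix x assume "x \<in> M"
    then have x: "x \<in> carrier G" and c: "\<And>y. y \<in> carrier G \<Longrightarrow>
      (N #> x) \<otimes>\<^bsub>G Mod N\<^esub> (N #> y) = (N #> y) \<otimes>\<^bsub>G Mod N\<^esub> (N #> x)" using M by blast+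
    have "(N #> inv x) \<otimes>\<^bsub>G Mod N\<^esub> (N #> y) = (N #> y) \<otimes>\<^bsub>G Mod N\<^esub> (N #> inv x)"
      if y: "y \<in> carrier G" for y
      using Q.inv_commute[OF h.hom_closed[OF x] h.hom_closed[OF y] c[OF y]] x
      by (simp only: h.hom_inv)
    then show "inv x \<in> M" unfolding M using x by blast
  next
    fix x z assume "x \<in> M" "z \<in> M"
    then have x: "x \<in> carrier G" "z \<in> carrier G" and c: "\<And>y. y \<in> carrier G \<Longrightarrow>
      (N #> x) \<otimes>\<^bsub>G Mod N\<^esub> (N #> y) = (N #> y) \<otimes>\<^bsub>G Mod N\<^esub> (N #> x)"
      "\<And>y. y \<in> carrier G \<Longrightarrow>
      (N #> z) \<otimes>\<^bsub>G Mod N\<^esub> (N #> y) = (N #> y) \<otimes>\<^bsub>G Mod N\<^esub> (N #> z)" using M by blast+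
    have "(N #> (x \<otimes> z)) \<otimes>\<^bsub>G Mod N\<^esub> (N #> y) = (N #> y) \<otimes>\<^bsub>G Mod N\<^esub> (N #> (x \<otimes> z))"
      if y: "y \<in> carrier G" for y
    proof -
      note cl = h.hom_closed[OF x(1)] h.hom_closed[OF x(2)] h.hom_closed[OF y]
      have "(N #> (x \<otimes> z)) \<otimes>\<^bsub>G Mod N\<^esub> (N #> y) = (N #> x) \<otimes>\<^bsub>G Mod N\<^esub> ((N #> z) \<otimes>\<^bsub>G Mod N\<^esub> (N #> y))"
        using x cl by (simp only: h.hom_mult Q.m_assoc)
      also have "\<dots> = ((N #> x) \<otimes>\<^bsub>G Mod N\<^esub> (N #> y)) \<otimes>\<^bsub>G Mod N\<^esub> (N #> z)"
        unfolding c(2)[OF y] using cl by (simp only: Q.m_assoc)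
      also have "\<dots> = (N #> y) \<otimes>\<^bsub>G Mod N\<^esub> (N #> (x \<otimes> z))"
        unfolding c(1)[OF y] using x cl by (simp only: h.hom_mult Q.m_assoc)
      finally show ?thesis .
    qed
    then show "x \<otimes> z \<in> M" unfolding M using x by blast
  qed
  show "M \<lhd> G"
  proof (rule normal_invI[OF sub])
    fix g x assume g: "g \<in> carrier G" and x: "x \<in> M"
    then have xc: "x \<in> carrier G" and xy: "x \<otimes> g \<otimes> inv x \<otimes> inv g \<in> N" by (auto simp: M_def)
    \<comment> \<open>The conjugate of \<open>x\<close> by \<open>g\<close> is \<open>x\<close>
      multiplied by the inverse of the commutator of \<open>x\<close> and \<open>g\<close>, which
      lies in \<open>N\<close> and hence in \<open>M\<close>.\<close>
    have "inv (x \<otimes> g \<otimes> inv x \<otimes> inv g) \<in> M" using xy NM by blast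
    then have "inv (x \<otimes> g \<otimes> inv x \<otimes> inv g) \<otimes> x \<in> M" using x subgroup.m_closed[OF sub] by blast
    moreover have "inv (x \<otimes> g \<otimes> inv x \<otimes> inv g) \<otimes> x = g \<otimes> x \<otimes> inv g"
      using g xc by (simp add: inv_mult_group m_assoc)
    ultimately show "g \<otimes> x \<otimes> inv g \<in> M" by simp
  qed
qed

text \<open>Induction on the index of \<open>N\<close>: the preimage in \<open>G\<close> of the center of \<open>G/N\<close> is strictly
  larger than \<open>N\<close>.\<close>

theorem (in group) p_group_nilpotent:
  assumes p: "prime p" and ord: "order G = p ^ k"
  shows "nilpotent_group G"
proof -
  have fin: "finite (carrier G)"
    using ord p by (simp add: prime_gt_0_nat flip: order_gt_0_iff_finite)
  \<comment> \<open>The second hypothesis says that the series becomes trivial once it has entered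
    \<open>N\<close>. It is evident for the trivial subgroup, is passed on to ever larger
    \<open>N\<close>, and for \<open>N = G\<close> applies to the 0-th term.\<close>
  have "\<exists>m. lower_central G m = {\<one>}"
    if "N \<lhd> G" "\<And>j. lower_central G j \<subseteq> N \<Longrightarrow> \<exists>m. lower_central G m = {\<one>}" for N
    using that
  proof (induction "card (carrier G) - card N" arbitrary: N rule: less_induct)
    case less
    interpret N: normal N G by (rule less.prems)
    show ?case
    proof (cases "N = carrier G")
      case True
      then show ?thesis using less.prems(2)[of 0] by simp
    next
      case False
      interpret Q: group "G Mod N" by (rule N.factorgroup_is_group)
      have "order (G Mod N) * card N = p ^ k"
        using lagrange[OF N.subgroup_axioms] ord by (simp add: order_def FactGroup_def)
      then have "order (G Mod N) dvd p ^ k" by (metis dvd_triv_left)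
      then obtain j where j: "order (G Mod N) = p ^ j" using p divides_primepow_nat by blast
      have "j > 0"
      proof (rule ccontr)
        assume "\<not> 0 < j"
        then have "card N = card (carrier G)"
          using lagrange[OF N.subgroup_axioms] j by (simp add: order_def FactGroup_def)
        then show False using False N.subset fin card_subset_eq by blast
      qed
      then obtain Z where Z: "Z \<in> carrier (G Mod N)" "Z \<noteq> \<one>\<^bsub>G Mod N\<^esub>"
        "\<And>Y. Y \<in> carrier (G Mod N) \<Longrightarrow> Z \<otimes>\<^bsub>G Mod N\<^esub> Y = Y \<otimes>\<^bsub>G Mod N\<^esub> Z"
        using Q.p_group_nontrivial_center[OF p j] by blast
      then obtain z where z: "z \<in> carrier G" "Z = N #> z" by (auto simp: carrier_FactGroup)
      let ?M = "{x \<in> carrier G. \<forall>y \<in> carrier G. x \<otimes> y \<otimes> inv x \<otimes> inv y \<in> N}"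
      note M = central_preimage_normal[OF less.prems(1)]
      have "(N #> z) <#> (N #> y) = (N #> y) <#> (N #> z)" if "y \<in> carrier G" for y
        using Z(3)[of "N #> y"] that z(2) by (simp add: carrier_FactGroup)
      then have "z \<in> ?M" using z(1) N.commute_mod_iff by blast
      moreover have "z \<notin> N" using Z(2) z by (auto simp: N.rcos_const)
      ultimately have "N \<subset> ?M" using M(2) by blast
      moreover have "?M \<subseteq> carrier G" by blast
      ultimately have "card (carrier G) - card ?M < card (carrier G) - card N"
        using fin by (meson card_mono diff_less_mono2 finite_subset less_le_trans psubset_card_mono)
      then show ?thesis
      proof (rule less.hyps[OF _ M(1)])
        fix j assume "lower_central G j \<subseteq> ?M"
        then have "lower_central G (Suc j) \<subseteq> N"
          by (intro lower_central_Suc_subset N.subgroup_axioms) blast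
        then show "\<exists>m. lower_central G m = {\<one>}" by (rule less.prems(2))
      qed
    qed
  qed
  moreover have "\<exists>m. lower_central G m = {\<one>}" if "lower_central G j \<subseteq> {\<one>}" for j
    using that subgroup.one_closed[OF normal_imp_subgroup[OF lower_central_normal, of j]] by blast
  ultimately show ?thesis
    using one_is_normal group_axioms unfolding nilpotent_group_def by blast
qed

text \<open>Another prime divisor \<open>q\<close> of the order would give a subgroup of order
  \<open>q\<close>, whose elements are annihilated by the coprime exponents \<open>q\<close> and
  \<open>p^k\<close>.\<close>

lemma (in group) p_group_of_pow_eq_one:
  assumes fin: "finite (carrier G)" and p: "prime p"
    and pow: "\<And>x. x \<in> carrier G \<Longrightarrow> x [^] (p ^ k :: nat) = \<one>"
  shows "\<exists>n. order G = p ^ n"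
proof -
  have "q = p" if q: "prime q" "q dvd order G" for q
  proof (rule ccontr)
    assume "q \<noteq> p"
    \<comment> \<open>The exponent 1 turns Sylow's theorem into Cauchy's.\<close>
    obtain m where "order G = q ^ 1 * m" using q(2) by auto
    then obtain H where H: "subgroup H G" "card H = q"
      using sylow_thm[OF q(1) group_axioms _ fin] by fastforce
    have "H \<noteq> {\<one>}" using H(2) q(1) by auto
    then obtain x where x: "x \<in> H" "x \<noteq> \<one>" using subgroup.one_closed[OF H(1)] by blast
    have xc: "x \<in> carrier G" using subgroup.mem_carrier[OF H(1) x(1)] .
    have "coprime q (p ^ k)" using primes_coprime[OF q(1) p \<open>q \<noteq> p\<close>] by simp
    then show False
      using coprime_pow_eq_one[OF xc _ pow[OF xc]] pow_card_subgroup[OF H(1) x(1)] H(2) x(2) by blast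
  qed
  then have "prime_factors (order G) \<subseteq> {p}" by (auto simp: prime_factors_dvd)
  moreover have "order G = (\<Prod>q\<in>prime_factors (order G). q ^ multiplicity q (order G))"
    using fin prime_factorization_nat by (simp add: order_gt_0_iff_finite)
  \<comment> \<open>The case \<open>p ^ 0\<close> is the trivial group, which has no prime
    factors.\<close>
  ultimately have "order G = p ^ multiplicity p (order G) \<or> order G = p ^ 0"
    by (metis power_0 prod.empty prod.insert finite.emptyI empty_iff mult.right_neutral subset_singletonD)
  then show ?thesis by blast
qed

subsection \<open>2-closures\<close>

lemma carrier_BijGroup [simp]: "carrier (BijGroup \<Omega>) = Bij \<Omega>"
  by (simp add: BijGroup_def)

lemma one_BijGroup_apply: "x \<in> \<Omega> \<Longrightarrow> \<one>\<^bsub>BijGroup \<Omega>\<^esub> x = x"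
  by (simp add: BijGroup_def)

lemma mult_BijGroup_apply:
  "f \<in> Bij \<Omega> \<Longrightarrow> g \<in> Bij \<Omega> \<Longrightarrow> x \<in> \<Omega> \<Longrightarrow> (f \<otimes>\<^bsub>BijGroup \<Omega>\<^esub> g) x = f (g x)"
  by (simp add: BijGroup_def compose_def)

lemma Bij_apply_closed: "f \<in> Bij \<Omega> \<Longrightarrow> x \<in> \<Omega> \<Longrightarrow> f x \<in> \<Omega>"
  using Bij_imp_funcset by blast

lemma Bij_eqI: "f \<in> Bij \<Omega> \<Longrightarrow> g \<in> Bij \<Omega> \<Longrightarrow> (\<And>x. x \<in> \<Omega> \<Longrightarrow> f x = g x) \<Longrightarrow> f = g"
  using Bij_imp_extensional extensionalityI by metis

lemma finite_Bij: "finite \<Omega> \<Longrightarrow> finite (Bij \<Omega>)"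
  by (rule finite_subset[OF _ finite_PiE[of \<Omega> "\<lambda>_. \<Omega>"]])
    (auto simp: Bij_def bij_betw_def PiE_def)

lemma subgroup_BijD: "subgroup H (BijGroup \<Omega>) \<Longrightarrow> h \<in> H \<Longrightarrow> h \<in> Bij \<Omega>"
  using subgroup.mem_carrier by fastforce

lemma pow_BijGroup_fixed:
  assumes "f \<in> Bij \<Omega>" "x \<in> \<Omega>" "f x = x"
  shows "(f [^]\<^bsub>BijGroup \<Omega>\<^esub> (n::nat)) x = x"
proof -
  interpret S: group "BijGroup \<Omega>" by (rule group_BijGroup)
  show ?thesis
  proof (induction n)
    case (Suc n)
    have "f [^]\<^bsub>BijGroup \<Omega>\<^esub> n \<in> Bij \<Omega>" using S.nat_pow_closed[of f n] assms(1) by simp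
    then show ?case using Suc assms by (simp add: mult_BijGroup_apply)
  qed (use assms in \<open>simp add: one_BijGroup_apply\<close>)
qed

text \<open>The working form of the 2-closure: a pair is moved within its orbit exactly if a single
  \<open>h\<close> agrees with \<open>f\<close> at both of its points. Most uses below rest on a
  suitable choice of this pair.\<close>

lemma mem_two_closure_iff:
  assumes "subgroup H (BijGroup \<Omega>)"
  shows "f \<in> two_closure \<Omega> H \<longleftrightarrow>
    f \<in> Bij \<Omega> \<and> (\<forall>x\<in>\<Omega>. \<forall>y\<in>\<Omega>. \<exists>h\<in>H. f x = h x \<and> f y = h y)"
  unfolding two_closure_eq[OF assms] mem_Collect_eq mem_orbit_iff by auto

lemma two_closure_mono:
  assumes "subgroup H (BijGroup \<Omega>)" "subgroup K (BijGroup \<Omega>)" "H \<subseteq> K"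
  shows "two_closure \<Omega> H \<subseteq> two_closure \<Omega> K"
  using assms(3) by (auto simp: mem_two_closure_iff assms(1,2)) (metis subsetD)

lemma two_closure_trivial: "two_closure \<Omega> {\<one>\<^bsub>BijGroup \<Omega>\<^esub>} = {\<one>\<^bsub>BijGroup \<Omega>\<^esub>}"
proof -
  interpret S: group "BijGroup \<Omega>" by (rule group_BijGroup)
  have "f = \<one>\<^bsub>BijGroup \<Omega>\<^esub>" if "f \<in> two_closure \<Omega> {\<one>\<^bsub>BijGroup \<Omega>\<^esub>}" for f
    using that S.one_closed
    by (intro Bij_eqI[of _ \<Omega>]) (auto simp: mem_two_closure_iff S.triv_subgroup)
  then show ?thesis
    using subgroup.one_closed[OF subgroup_two_closure[OF S.triv_subgroup]] by blast
qed

text \<open>The graph of a permutation centralizing \<open>H\<close> is a union of 2-orbits of \<open>H\<close>.\<close>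

lemma two_closure_commute:
  assumes H: "subgroup H (BijGroup \<Omega>)" and k: "k \<in> Bij \<Omega>"
    and comm: "\<And>h. h \<in> H \<Longrightarrow> h \<otimes>\<^bsub>BijGroup \<Omega>\<^esub> k = k \<otimes>\<^bsub>BijGroup \<Omega>\<^esub> h"
    and f: "f \<in> two_closure \<Omega> H"
  shows "f \<otimes>\<^bsub>BijGroup \<Omega>\<^esub> k = k \<otimes>\<^bsub>BijGroup \<Omega>\<^esub> f"
proof -
  interpret S: group "BijGroup \<Omega>" by (rule group_BijGroup)
  have fB: "f \<in> Bij \<Omega>" using f H by (simp add: mem_two_closure_iff)
  show ?thesis
  proof (rule Bij_eqI)
    fix x assume x: "x \<in> \<Omega>"
    obtain h where h: "h \<in> H" "f x = h x" "f (k x) = h (k x)"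
      using f x Bij_apply_closed[OF k x] by (auto simp: mem_two_closure_iff H)
    have "h (k x) = k (h x)"
      using comm[OF h(1)] mult_BijGroup_apply[of h \<Omega> k x] mult_BijGroup_apply[of k \<Omega> h x]
        subgroup_BijD[OF H h(1)] k x by simp
    then show "(f \<otimes>\<^bsub>BijGroup \<Omega>\<^esub> k) x = (k \<otimes>\<^bsub>BijGroup \<Omega>\<^esub> f) x"
      using h fB k x by (simp add: mult_BijGroup_apply)
  qed (use S.m_closed[of f k] S.m_closed[of k f] fB k in simp_all)
qed

section \<open>Closures of commuting groups of coprime orders\<close>

lemma two_closures_commute:
  assumes A: "subgroup A (BijGroup \<Omega>)" and B: "subgroup B (BijGroup \<Omega>)"
    and comm: "\<And>a b. a \<in> A \<Longrightarrow> b \<in> B \<Longrightarrow> a \<otimes>\<^bsub>BijGroup \<Omega>\<^esub> b = b \<otimes>\<^bsub>BijGroup \<Omega>\<^esub> a"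
    and f: "f \<in> two_closure \<Omega> A" and g: "g \<in> two_closure \<Omega> B"
  shows "f \<otimes>\<^bsub>BijGroup \<Omega>\<^esub> g = g \<otimes>\<^bsub>BijGroup \<Omega>\<^esub> f"
proof -
  \<comment> \<open>Each \<open>b\<close> centralizes \<open>A\<close>, hence also \<open>f\<close>.
    So \<open>f\<close> centralizes \<open>B\<close>, and hence the closure of
    \<open>B\<close>.\<close>
  have "b \<otimes>\<^bsub>BijGroup \<Omega>\<^esub> f = f \<otimes>\<^bsub>BijGroup \<Omega>\<^esub> b" if "b \<in> B" for b
    using two_closure_commute[OF A subgroup_BijD[OF B that] comm[OF _ that] f] by simp
  moreover have "f \<in> Bij \<Omega>" using f A by (simp add: mem_two_closure_iff)
  ultimately show ?thesis
    using two_closure_commute[OF B _ _ g] by metis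
qed

text \<open>A power of \<open>a b\<close> whose exponent is divisible by \<open>card B\<close> and
  congruent to 1 modulo \<open>card A\<close> equals \<open>a\<close>, and it fixes \<open>x\<close>
  along with \<open>a b\<close>.\<close>

lemma coprime_factor_fixes:
  assumes fin: "finite \<Omega>" and A: "subgroup A (BijGroup \<Omega>)" and B: "subgroup B (BijGroup \<Omega>)"
    and co: "coprime (card A) (card B)" and a: "a \<in> A" and b: "b \<in> B"
    and comm: "a \<otimes>\<^bsub>BijGroup \<Omega>\<^esub> b = b \<otimes>\<^bsub>BijGroup \<Omega>\<^esub> a"
    and x: "x \<in> \<Omega>" "a (b x) = x"
  shows "a x = x"
proof -
  interpret S: group "BijGroup \<Omega>" by (rule group_BijGroup)
  have aB: "a \<in> Bij \<Omega>" and bB: "b \<in> Bij \<Omega>" using a b A B subgroup_BijD by blast+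
  have abB: "a \<otimes>\<^bsub>BijGroup \<Omega>\<^esub> b \<in> Bij \<Omega>" using S.m_closed[of a b] aB bB by simp
  \<comment> \<open>The Bezout identity over the naturals has its \<open>+ 1\<close> on the side of
    \<open>card A\<close>, which excludes \<open>card B = 0\<close>.\<close>
  have "finite B" using fin finite_Bij subgroup.subset[OF B] finite_subset by fastforce
  then have "card B \<noteq> 0" using b by auto
  then obtain u v where uv: "card B * u = card A * v + 1"
    using bezout_nat[of "card B" "card A"] co by (auto simp: coprime_iff_gcd_eq_1 gcd.commute)
  have "(a \<otimes>\<^bsub>BijGroup \<Omega>\<^esub> b) [^]\<^bsub>BijGroup \<Omega>\<^esub> (card B * u) =
      a [^]\<^bsub>BijGroup \<Omega>\<^esub> (card B * u) \<otimes>\<^bsub>BijGroup \<Omega>\<^esub> b [^]\<^bsub>BijGroup \<Omega>\<^esub> (card B * u)"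
    using S.pow_mult_distrib[OF comm] aB bB by simp
  also have "b [^]\<^bsub>BijGroup \<Omega>\<^esub> (card B * u) = \<one>\<^bsub>BijGroup \<Omega>\<^esub>"
    using S.pow_card_subgroup[OF B b] bB by (simp flip: S.nat_pow_pow)
  also have "a [^]\<^bsub>BijGroup \<Omega>\<^esub> (card B * u) = a"
    using S.pow_card_subgroup[OF A a] aB unfolding uv
    by (simp flip: S.nat_pow_mult S.nat_pow_pow)
  finally have "(a \<otimes>\<^bsub>BijGroup \<Omega>\<^esub> b) [^]\<^bsub>BijGroup \<Omega>\<^esub> (card B * u) = a" using aB by simp
  moreover have "(a \<otimes>\<^bsub>BijGroup \<Omega>\<^esub> b) x = x" using aB bB x by (simp add: mult_BijGroup_apply)
  ultimately show ?thesis using pow_BijGroup_fixed[OF abB x(1)] by metis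
qed

text \<open>As the groups commute, the product of \<open>a'^-1 a\<close> and \<open>b'^-1 b\<close>
  fixes \<open>x\<close>. By the preceding lemma \<open>a'^-1 a\<close> fixes \<open>x\<close> as
  well.\<close>

lemma coprime_factor_determined:
  assumes fin: "finite \<Omega>" and A: "subgroup A (BijGroup \<Omega>)" and B: "subgroup B (BijGroup \<Omega>)"
    and co: "coprime (card A) (card B)"
    and comm: "\<And>a b. a \<in> A \<Longrightarrow> b \<in> B \<Longrightarrow> a \<otimes>\<^bsub>BijGroup \<Omega>\<^esub> b = b \<otimes>\<^bsub>BijGroup \<Omega>\<^esub> a"
    and ab: "a \<in> A" "a' \<in> A" "b \<in> B" "b' \<in> B"
    and x: "x \<in> \<Omega>" "a (b x) = a' (b' x)"
  shows "a x = a' x"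
proof -
  let ?S = "BijGroup \<Omega>"
  interpret S: group ?S by (rule group_BijGroup)
  have c: "a \<in> Bij \<Omega>" "a' \<in> Bij \<Omega>" "b \<in> Bij \<Omega>" "b' \<in> Bij \<Omega>"
    using ab A B subgroup_BijD by blast+
  have ci: "inv\<^bsub>?S\<^esub> a' \<in> Bij \<Omega>" "inv\<^bsub>?S\<^esub> b' \<in> Bij \<Omega>"
    using S.inv_closed[of a'] S.inv_closed[of b'] c by simp_all
  note mc = Bij_apply_closed
  have inv_app: "(inv\<^bsub>?S\<^esub> g) (g y) = y" if "g \<in> Bij \<Omega>" "y \<in> \<Omega>" for g y
    using mult_BijGroup_apply[of "inv\<^bsub>?S\<^esub> g" \<Omega> g y] S.l_inv[of g] S.inv_closed[of g] that
    by (simp add: one_BijGroup_apply)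
  let ?u = "inv\<^bsub>?S\<^esub> a' \<otimes>\<^bsub>?S\<^esub> a"
  have u: "?u \<in> A" and v: "inv\<^bsub>?S\<^esub> b' \<otimes>\<^bsub>?S\<^esub> b \<in> B"
    using ab subgroup.m_closed[OF A] subgroup.m_inv_closed[OF A]
      subgroup.m_closed[OF B] subgroup.m_inv_closed[OF B] by blast+
  have 1: "?u ((inv\<^bsub>?S\<^esub> b' \<otimes>\<^bsub>?S\<^esub> b) x) = x"
  proof -
    have "a \<otimes>\<^bsub>?S\<^esub> inv\<^bsub>?S\<^esub> b' = inv\<^bsub>?S\<^esub> b' \<otimes>\<^bsub>?S\<^esub> a"
      using comm[OF ab(1) subgroup.m_inv_closed[OF B ab(4)]] .
    then have e1: "a ((inv\<^bsub>?S\<^esub> b') y) = (inv\<^bsub>?S\<^esub> b') (a y)" if "y \<in> \<Omega>" for y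
      using c ci that mult_BijGroup_apply[of a \<Omega> "inv\<^bsub>?S\<^esub> b'" y]
        mult_BijGroup_apply[of "inv\<^bsub>?S\<^esub> b'" \<Omega> a y] by simp
    have "a' \<otimes>\<^bsub>?S\<^esub> b' = b' \<otimes>\<^bsub>?S\<^esub> a'" using comm[OF ab(2,4)] .
    then have e2: "a' (b' x) = b' (a' x)"
      using c x(1) mult_BijGroup_apply[of a' \<Omega> b' x] mult_BijGroup_apply[of b' \<Omega> a' x] by simp
    have "?u ((inv\<^bsub>?S\<^esub> b' \<otimes>\<^bsub>?S\<^esub> b) x) = (inv\<^bsub>?S\<^esub> a') (a ((inv\<^bsub>?S\<^esub> b') (b x)))"
      using c ci x(1) by (simp add: mult_BijGroup_apply mc)
    also have "\<dots> = (inv\<^bsub>?S\<^esub> a') ((inv\<^bsub>?S\<^esub> b') (b' (a' x)))"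
      using e1[of "b x"] c x e2 by (simp add: mc)
    also have "\<dots> = x" using c x(1) by (simp add: inv_app mc)
    finally show ?thesis .
  qed
  have "?u x = x"
    by (rule coprime_factor_fixes[OF fin A B co u v comm[OF u v] x(1) 1])
  then have "(inv\<^bsub>?S\<^esub> a') (a x) = (inv\<^bsub>?S\<^esub> a') (a' x)"
    using c ci x(1) by (simp add: mult_BijGroup_apply inv_app)
  moreover have "inj_on (inv\<^bsub>?S\<^esub> a') \<Omega>" using ci(1) by (simp add: Bij_def bij_betw_def)
  ultimately show ?thesis using c x(1) mc by (metis inj_onD)
qed

text \<open>\<open>f\<^sub>A\<close> sends \<open>x\<close> to \<open>a x\<close> for any
  representation \<open>f x = a (b x)\<close>; by the preceding lemma the choice does not matter.
  Any two points admit a common \<open>a\<close>, which makes \<open>f\<^sub>A\<close> injective and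
  puts it into the closure of \<open>A\<close>.\<close>

lemma two_closure_coprime_factor:
  assumes fin: "finite \<Omega>" and A: "subgroup A (BijGroup \<Omega>)" and B: "subgroup B (BijGroup \<Omega>)"
    and co: "coprime (card A) (card B)"
    and comm: "\<And>a b. a \<in> A \<Longrightarrow> b \<in> B \<Longrightarrow> a \<otimes>\<^bsub>BijGroup \<Omega>\<^esub> b = b \<otimes>\<^bsub>BijGroup \<Omega>\<^esub> a"
    and f: "f \<in> two_closure \<Omega> (A <#>\<^bsub>BijGroup \<Omega>\<^esub> B)"
  shows "\<exists>f\<^sub>A \<in> two_closure \<Omega> A. \<forall>x\<in>\<Omega>. \<forall>a\<in>A. \<forall>b\<in>B. f x = a (b x) \<longrightarrow> f\<^sub>A x = a x"
proof -
  let ?S = "BijGroup \<Omega>"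
  interpret S: group ?S by (rule group_BijGroup)
  have AB: "subgroup (A <#>\<^bsub>?S\<^esub> B) ?S" by (rule S.commuting_set_mult_subgroup[OF A B comm])
  note cA = subgroup_BijD[OF A] and cB = subgroup_BijD[OF B]
  have ex: "\<exists>a\<in>A. \<exists>b\<in>B. f x = a (b x) \<and> f y = a (b y)" if xy: "x \<in> \<Omega>" "y \<in> \<Omega>" for x y
  proof -
    obtain g where g: "g \<in> A <#>\<^bsub>?S\<^esub> B" "f x = g x" "f y = g y"
      using f xy unfolding mem_two_closure_iff[OF AB] by blast
    then obtain a b where ab: "a \<in> A" "b \<in> B" "g = a \<otimes>\<^bsub>?S\<^esub> b" unfolding set_mult_def by blast
    then have "g z = a (b z)" if "z \<in> \<Omega>" for z
      using mult_BijGroup_apply[OF cA cB] that by blast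
    then show ?thesis using ab g xy by auto
  qed
  \<comment> \<open>The restricted abstraction makes \<open>F\<close> undefined outside
    \<open>\<Omega>\<close>, as \<open>Bij\<close> demands.\<close>
  define F where "F = (\<lambda>x\<in>\<Omega>. (SOME a. a \<in> A \<and> (\<exists>b\<in>B. f x = a (b x))) x)"
  have F: "F x = a x" if "x \<in> \<Omega>" "a \<in> A" "b \<in> B" "f x = a (b x)" for x a b
  proof -
    let ?a = "SOME a. a \<in> A \<and> (\<exists>b\<in>B. f x = a (b x))"
    have "?a \<in> A \<and> (\<exists>b\<in>B. f x = ?a (b x))" by (rule someI[of _ a]) (use that in blast)
    then show ?thesis
      using coprime_factor_determined[OF fin A B co comm] that by (auto simp: F_def)
  qed
  have F2: "\<exists>a\<in>A. F x = a x \<and> F y = a y" if "x \<in> \<Omega>" "y \<in> \<Omega>" for x y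
    using ex[OF that] F that by blast
  have "F \<in> Bij \<Omega>"
  proof -
    have "inj_on F \<Omega>"
    proof (rule inj_onI)
      fix x y assume xy: "x \<in> \<Omega>" "y \<in> \<Omega>" "F x = F y"
      then obtain a where a: "a \<in> A" "F x = a x" "F y = a y" using F2 by blast
      then have "inj_on a \<Omega>" using cA by (auto simp: Bij_def bij_betw_def)
      then show "x = y" using a xy by (auto dest: inj_onD)
    qed
    moreover have "F ` \<Omega> \<subseteq> \<Omega>"
    proof
      fix y assume "y \<in> F ` \<Omega>"
      then obtain x where x: "x \<in> \<Omega>" "y = F x" by blast
      then obtain a where "a \<in> A" "F x = a x" using F2 by blast
      then show "y \<in> \<Omega>" using x cA Bij_apply_closed by metis
    qed
    ultimately have "bij_betw F \<Omega> \<Omega>"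
      using fin by (simp add: bij_betw_def endo_inj_surj)
    then show ?thesis by (simp add: Bij_def F_def)
  qed
  then have "F \<in> two_closure \<Omega> A" using F2 by (simp add: mem_two_closure_iff[OF A])
  then show ?thesis using F by blast
qed

text \<open>For one inclusion \<open>f\<close> is recovered as the product of its two components;
  the other follows from monotonicity of the closure.\<close>

lemma two_closure_coprime_product:
  assumes fin: "finite \<Omega>" and A: "subgroup A (BijGroup \<Omega>)" and B: "subgroup B (BijGroup \<Omega>)"
    and co: "coprime (card A) (card B)"
    and comm: "\<And>a b. a \<in> A \<Longrightarrow> b \<in> B \<Longrightarrow> a \<otimes>\<^bsub>BijGroup \<Omega>\<^esub> b = b \<otimes>\<^bsub>BijGroup \<Omega>\<^esub> a"
  shows "two_closure \<Omega> (A <#>\<^bsub>BijGroup \<Omega>\<^esub> B) = two_closure \<Omega> A <#>\<^bsub>BijGroup \<Omega>\<^esub> two_closure \<Omega> B"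
proof
  let ?S = "BijGroup \<Omega>"
  interpret S: group ?S by (rule group_BijGroup)
  have AB: "subgroup (A <#>\<^bsub>?S\<^esub> B) ?S" by (rule S.commuting_set_mult_subgroup[OF A B comm])
  note cA = subgroup_BijD[OF A] and cB = subgroup_BijD[OF B]
  \<comment> \<open>This symmetry allows the preceding lemma to be applied with \<open>A\<close> and
    \<open>B\<close> exchanged, which yields \<open>fB\<close>.\<close>
  have eq: "A <#>\<^bsub>?S\<^esub> B = B <#>\<^bsub>?S\<^esub> A" using comm by (auto simp: set_mult_def) (metis comm)+
  show "two_closure \<Omega> (A <#>\<^bsub>?S\<^esub> B) \<subseteq> two_closure \<Omega> A <#>\<^bsub>?S\<^esub> two_closure \<Omega> B"
  proof
    fix f assume f: "f \<in> two_closure \<Omega> (A <#>\<^bsub>?S\<^esub> B)"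
    have fB: "f \<in> Bij \<Omega>" using f by (simp add: mem_two_closure_iff[OF AB])
    obtain fA where fA: "fA \<in> two_closure \<Omega> A"
      "\<And>x a b. x \<in> \<Omega> \<Longrightarrow> a \<in> A \<Longrightarrow> b \<in> B \<Longrightarrow> f x = a (b x) \<Longrightarrow> fA x = a x"
      using two_closure_coprime_factor[OF fin A B co comm f] by blast
    obtain fB where fB: "fB \<in> two_closure \<Omega> B"
      "\<And>x a b. x \<in> \<Omega> \<Longrightarrow> b \<in> B \<Longrightarrow> a \<in> A \<Longrightarrow> f x = b (a x) \<Longrightarrow> fB x = b x"
      using two_closure_coprime_factor[OF fin B A _ comm[symmetric], of f] co f
      unfolding eq by (metis coprime_commute)
    have c: "fA \<in> Bij \<Omega>" "fB \<in> Bij \<Omega>"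
      using fA(1) fB(1) by (simp_all add: mem_two_closure_iff A B)
    have "f = fA \<otimes>\<^bsub>?S\<^esub> fB"
    proof (rule Bij_eqI)
      fix x assume x: "x \<in> \<Omega>"
      have y: "fB x \<in> \<Omega>" by (rule Bij_apply_closed[OF c(2) x])
      \<comment> \<open>One \<open>g = a b\<close> serves both points of the pair \<open>x\<close>,
        \<open>fB x\<close>: the first gives \<open>fB x = b x\<close>, the second
        \<open>fA (fB x) = a (fB x)\<close>, and together they give
        \<open>fA (fB x) = a (b x) = f x\<close>.\<close>
      obtain g where g: "g \<in> A <#>\<^bsub>?S\<^esub> B" "f x = g x" "f (fB x) = g (fB x)"
        using f x y unfolding mem_two_closure_iff[OF AB] by blast
      then obtain a b where ab: "a \<in> A" "b \<in> B" "g = a \<otimes>\<^bsub>?S\<^esub> b" unfolding set_mult_def by blast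
      have g1: "g z = a (b z)" if "z \<in> \<Omega>" for z
        using ab that cA cB by (simp add: mult_BijGroup_apply)
      have g2: "g z = b (a z)" if "z \<in> \<Omega>" for z
        unfolding ab(3) comm[OF ab(1,2)] by (rule mult_BijGroup_apply[OF cB[OF ab(2)] cA[OF ab(1)] that])
      have "fB x = b x" using fB(2)[OF x ab(2,1)] g g2 x by simp
      moreover have "fA (fB x) = a (fB x)" using fA(2)[OF y ab(1,2)] g g1 y by simp
      ultimately show "f x = (fA \<otimes>\<^bsub>?S\<^esub> fB) x" using c g g1 x by (simp add: mult_BijGroup_apply)
    qed (use \<open>f \<in> Bij \<Omega>\<close> c S.m_closed[of fA fB] in simp_all)
    then show "f \<in> two_closure \<Omega> A <#>\<^bsub>?S\<^esub> two_closure \<Omega> B"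
      using fA(1) fB(1) unfolding set_mult_def by blast
  qed
  have "A \<subseteq> A <#>\<^bsub>?S\<^esub> B" "B \<subseteq> A <#>\<^bsub>?S\<^esub> B"
  proof -
    show "A \<subseteq> A <#>\<^bsub>?S\<^esub> B"
    proof
      fix a assume "a \<in> A"
      then have "a \<otimes>\<^bsub>?S\<^esub> \<one>\<^bsub>?S\<^esub> = a" using cA by simp
      then show "a \<in> A <#>\<^bsub>?S\<^esub> B" using \<open>a \<in> A\<close> subgroup.one_closed[OF B] unfolding set_mult_def by force
    qed
    show "B \<subseteq> A <#>\<^bsub>?S\<^esub> B"
    proof
      fix b assume "b \<in> B"
      then have "\<one>\<^bsub>?S\<^esub> \<otimes>\<^bsub>?S\<^esub> b = b" using cB by simp
      then show "b \<in> A <#>\<^bsub>?S\<^esub> B" using \<open>b \<in> B\<close> subgroup.one_closed[OF A] unfolding set_mult_def by force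
    qed
  qed
  then have "two_closure \<Omega> A \<subseteq> two_closure \<Omega> (A <#>\<^bsub>?S\<^esub> B)"
    "two_closure \<Omega> B \<subseteq> two_closure \<Omega> (A <#>\<^bsub>?S\<^esub> B)"
    using two_closure_mono A B AB by blast+
  then show "two_closure \<Omega> A <#>\<^bsub>?S\<^esub> two_closure \<Omega> B \<subseteq> two_closure \<Omega> (A <#>\<^bsub>?S\<^esub> B)"
    using subgroup.m_closed[OF subgroup_two_closure[OF AB]] unfolding set_mult_def by blast
qed

section \<open>Exponent of the closure and the case of \<open>p\<close>-groups\<close>

text \<open>If \<open>g x = z x\<close> with \<open>z\<close> in the \<open>i\<close>-th term \<open>L\<^sub>i\<close> of the lower central series of \<open>G\<close>, then
  the \<open>G\<close>-invariant relation \<open>v \<in> L\<^sub>i\<^sub>+\<^sub>1 z u\<close> between \<open>u\<close> and \<open>v\<close> is preserved by \<open>g\<close> and contains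
  \<open>(x, g x)\<close>. Hence \<open>g\<^sup>n x \<in> L\<^sub>i\<^sub>+\<^sub>1 z\<^sup>n x\<close>.\<close>

lemma two_closure_pow_lower_central:
  assumes G: "subgroup G (BijGroup \<Omega>)" and f: "f \<in> two_closure \<Omega> G" and x: "x \<in> \<Omega>"
  shows "\<exists>z \<in> lower_central ((BijGroup \<Omega>)\<lparr>carrier := G\<rparr>) i.
    (f [^]\<^bsub>BijGroup \<Omega>\<^esub> (card G ^ i)) x = z x"
  using x
proof (induction i arbitrary: x)
  case 0
  interpret S: group "BijGroup \<Omega>" by (rule group_BijGroup)
  show ?case using f 0 by (auto simp: mem_two_closure_iff[OF G])
next
  case (Suc i)
  let ?S = "BijGroup \<Omega>" and ?G = "(BijGroup \<Omega>)\<lparr>carrier := G\<rparr>"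
  interpret S: group ?S by (rule group_BijGroup)
  interpret G: group ?G by (rule S.subgroup_imp_group[OF G])
  interpret C: group "?S\<lparr>carrier := two_closure \<Omega> G\<rparr>"
    by (rule S.subgroup_imp_group[OF subgroup_two_closure[OF G]])
  define L where "L = lower_central ?G (Suc i)"
  interpret L: normal L ?G unfolding L_def by (rule G.lower_central_normal)
  have fB: "f \<in> carrier ?S" using f by (simp add: mem_two_closure_iff[OF G])
  define g where "g = f [^]\<^bsub>?S\<^esub> (card G ^ i)"
  have pw: "h [^]\<^bsub>?S\<^esub> (n::nat) \<in> two_closure \<Omega> G" if "h \<in> two_closure \<Omega> G" for h n
    using C.nat_pow_closed[of h n] that by (simp flip: S.nat_pow_consistent)
  have g: "g \<in> two_closure \<Omega> G" unfolding g_def by (rule pw[OF f])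
  obtain z where z: "z \<in> lower_central ?G i" "g x = z x"
    using Suc by (auto simp: g_def)
  have zG: "z \<in> G"
    using subgroup.mem_carrier[OF normal_imp_subgroup[OF G.lower_central_normal] z(1)] by simp
  have LG: "u \<in> G" if "u \<in> L" for u using L.mem_carrier[OF that] by simp
  note GB = subgroup_BijD[OF G]
  have zp: "z [^]\<^bsub>?S\<^esub> (n::nat) \<in> G" for n
    using G.nat_pow_closed[of z n] zG by (simp flip: S.nat_pow_consistent)
  have "\<exists>u\<in>L. (g [^]\<^bsub>?S\<^esub> n) x = (u \<otimes>\<^bsub>?S\<^esub> z [^]\<^bsub>?S\<^esub> n) x" for n :: nat
  proof (induction n)
    case 0
    show ?case using Suc.prems L.one_closed by (intro bexI[of _ "\<one>\<^bsub>?S\<^esub>"]) (simp_all del: carrier_BijGroup)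
  next
    case (Suc n)
    then obtain u where u: "u \<in> L" "(g [^]\<^bsub>?S\<^esub> n) x = (u \<otimes>\<^bsub>?S\<^esub> z [^]\<^bsub>?S\<^esub> n) x" by blast
    have gB: "g \<in> Bij \<Omega>" "g [^]\<^bsub>?S\<^esub> n \<in> Bij \<Omega>"
      using g pw[OF g, of n] by (simp_all add: mem_two_closure_iff[OF G])
    \<comment> \<open>For the pair \<open>x\<close>, \<open>g x\<close> the power \<open>g^n\<close>
      agrees with one \<open>h\<close> in \<open>G\<close>, so \<open>g^(n+1) x = h (z x)\<close>.
      Exchanging \<open>h\<close> and \<open>z\<close> costs the commutator \<open>k\<close> and
      leads back to \<open>h x = g^n x\<close>.\<close>
    obtain h where h: "h \<in> G" "(g [^]\<^bsub>?S\<^esub> n) x = h x" "(g [^]\<^bsub>?S\<^esub> n) (g x) = h (g x)"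
      using pw[OF g, of n] \<open>x \<in> \<Omega>\<close> Bij_apply_closed[OF gB(1) \<open>x \<in> \<Omega>\<close>]
      unfolding mem_two_closure_iff[OF G] by blast
    note B = GB[OF h(1)] GB[OF zG] GB[OF LG[OF u(1)]] GB[OF zp[of n]]
    have c: "h \<in> carrier ?S" "z \<in> carrier ?S" "u \<in> carrier ?S" "z [^]\<^bsub>?S\<^esub> n \<in> carrier ?S"
      using B by simp_all
    define k where "k = h \<otimes>\<^bsub>?S\<^esub> z \<otimes>\<^bsub>?S\<^esub> inv\<^bsub>?S\<^esub> h \<otimes>\<^bsub>?S\<^esub> inv\<^bsub>?S\<^esub> z"
    \<comment> \<open>The series is generated by commutators with \<open>z\<close> in front;
      \<open>k\<close> has \<open>h\<close> in front, so it is the inverse of one of these.\<close>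
    have kL: "k \<in> L"
    proof -
      have "z \<otimes>\<^bsub>?G\<^esub> h \<otimes>\<^bsub>?G\<^esub> inv\<^bsub>?G\<^esub> z \<otimes>\<^bsub>?G\<^esub> inv\<^bsub>?G\<^esub> h \<in> L"
        unfolding L_def using G.commutator_in_lower_central_Suc[OF z(1), of h] h(1) by simp
      then have "inv\<^bsub>?G\<^esub> (z \<otimes>\<^bsub>?G\<^esub> h \<otimes>\<^bsub>?G\<^esub> inv\<^bsub>?G\<^esub> z \<otimes>\<^bsub>?G\<^esub> inv\<^bsub>?G\<^esub> h) \<in> L" by (rule L.m_inv_closed)
      also have "inv\<^bsub>?G\<^esub> (z \<otimes>\<^bsub>?G\<^esub> h \<otimes>\<^bsub>?G\<^esub> inv\<^bsub>?G\<^esub> z \<otimes>\<^bsub>?G\<^esub> inv\<^bsub>?G\<^esub> h) =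
          h \<otimes>\<^bsub>?G\<^esub> z \<otimes>\<^bsub>?G\<^esub> inv\<^bsub>?G\<^esub> h \<otimes>\<^bsub>?G\<^esub> inv\<^bsub>?G\<^esub> z"
        using h(1) zG by (intro G.inv_commutator) simp_all
      finally show ?thesis
        using h(1) zG by (simp add: k_def S.m_inv_consistent[OF G])
    qed
    \<comment> \<open>Chosen so that \<open>z u = v z\<close>, which moves \<open>u\<close> in front
      of the powers of \<open>z\<close>.\<close>
    define v where "v = z \<otimes>\<^bsub>?S\<^esub> u \<otimes>\<^bsub>?S\<^esub> inv\<^bsub>?S\<^esub> z"
    have vL: "v \<in> L"
      using L.inv_op_closed2[of z u] zG u(1) by (simp add: v_def S.m_inv_consistent[OF G])
    have kc: "k \<in> carrier ?S" "v \<in> carrier ?S" using GB[OF LG] kL vL by simp_all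
    have hz: "h \<otimes>\<^bsub>?S\<^esub> z = k \<otimes>\<^bsub>?S\<^esub> (z \<otimes>\<^bsub>?S\<^esub> h)"
      using S.commutator_eq_iff[OF c(1,2) kc(1)] k_def by simp
    have "(g [^]\<^bsub>?S\<^esub> Suc n) x = (h \<otimes>\<^bsub>?S\<^esub> z) x"
      using h z(2) gB B \<open>x \<in> \<Omega>\<close> by (simp add: mult_BijGroup_apply)
    also have "\<dots> = k (z (h x))"
      unfolding hz using B kc c S.m_closed[OF c(2,1)] \<open>x \<in> \<Omega>\<close> by (simp add: mult_BijGroup_apply)
    also have "\<dots> = k (z ((u \<otimes>\<^bsub>?S\<^esub> z [^]\<^bsub>?S\<^esub> n) x))" using h u by simp
    also have "\<dots> = (k \<otimes>\<^bsub>?S\<^esub> (z \<otimes>\<^bsub>?S\<^esub> (u \<otimes>\<^bsub>?S\<^esub> z [^]\<^bsub>?S\<^esub> n))) x"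
      using B kc S.m_closed[OF c(3,4)] S.m_closed[OF c(2) S.m_closed[OF c(3,4)]] \<open>x \<in> \<Omega>\<close>
      by (simp add: mult_BijGroup_apply)
    also have "k \<otimes>\<^bsub>?S\<^esub> (z \<otimes>\<^bsub>?S\<^esub> (u \<otimes>\<^bsub>?S\<^esub> z [^]\<^bsub>?S\<^esub> n)) = (k \<otimes>\<^bsub>?S\<^esub> v) \<otimes>\<^bsub>?S\<^esub> z [^]\<^bsub>?S\<^esub> Suc n"
      using c kc unfolding v_def S.nat_pow_Suc2[OF c(2)]
      by (simp add: S.m_assoc S.inv_mult_cancel del: carrier_BijGroup)
    finally show ?case
      using L.m_closed[OF kL vL] by (intro bexI[of _ "k \<otimes>\<^bsub>?S\<^esub> v"]) simp_all
  qed
  \<comment> \<open>At the exponent \<open>card G\<close> the power of \<open>z\<close> is trivial,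
    so only \<open>u\<close> in the next term is left.\<close>
  then obtain u where u: "u \<in> L" "(g [^]\<^bsub>?S\<^esub> card G) x = (u \<otimes>\<^bsub>?S\<^esub> z [^]\<^bsub>?S\<^esub> card G) x" by blast
  have "g [^]\<^bsub>?S\<^esub> card G = f [^]\<^bsub>?S\<^esub> (card G ^ Suc i)"
    unfolding g_def using S.nat_pow_pow[OF fB] by (simp add: mult.commute)
  moreover have "u \<otimes>\<^bsub>?S\<^esub> z [^]\<^bsub>?S\<^esub> card G = u"
    using S.pow_card_subgroup[OF G zG] GB[OF LG[OF u(1)]] by simp
  ultimately show ?case using u unfolding L_def by metis
qed

text \<open>Once the series of \<open>P\<close> is trivial at \<open>c\<close>, the preceding lemma
  shows that \<open>f^(card P ^ c)\<close> fixes every point. So the closure has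
  \<open>p\<close>-power exponent and is a \<open>p\<close>-group.\<close>

lemma two_closure_p_group_nilpotent:
  assumes fin: "finite \<Omega>" and P: "subgroup P (BijGroup \<Omega>)" and p: "prime p" "card P = p ^ k"
  shows "nilpotent_group ((BijGroup \<Omega>)\<lparr>carrier := two_closure \<Omega> P\<rparr>)"
proof -
  let ?S = "BijGroup \<Omega>" and ?P = "(BijGroup \<Omega>)\<lparr>carrier := P\<rparr>"
    and ?C = "(BijGroup \<Omega>)\<lparr>carrier := two_closure \<Omega> P\<rparr>"
  interpret S: group ?S by (rule group_BijGroup)
  interpret P: group ?P by (rule S.subgroup_imp_group[OF P])
  have C: "subgroup (two_closure \<Omega> P) ?S" by (rule subgroup_two_closure[OF P])
  interpret C: group ?C by (rule S.subgroup_imp_group[OF C])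
  have "nilpotent_group ?P" using P.p_group_nilpotent[OF p(1), of k] p(2) by (simp add: order_def)
  then obtain c where c: "lower_central ?P c = {\<one>\<^bsub>?S\<^esub>}" by (auto simp: nilpotent_group_def)
  have "f [^]\<^bsub>?C\<^esub> (p ^ (k * c)) = \<one>\<^bsub>?C\<^esub>" if "f \<in> carrier ?C" for f
  proof -
    have f: "f \<in> two_closure \<Omega> P" using that by simp
    have fB: "f \<in> carrier ?S" using f by (simp add: mem_two_closure_iff[OF P])
    have "f [^]\<^bsub>?S\<^esub> (card P ^ c) = \<one>\<^bsub>?S\<^esub>"
    proof (rule Bij_eqI[of _ \<Omega>])
      show "(f [^]\<^bsub>?S\<^esub> (card P ^ c)) x = \<one>\<^bsub>?S\<^esub> x" if "x \<in> \<Omega>" for x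
        using two_closure_pow_lower_central[OF P f that, of c] c by simp
    qed (use S.nat_pow_closed[OF fB] S.one_closed in simp_all)
    then show ?thesis by (simp add: p(2) power_mult flip: S.nat_pow_consistent)
  qed
  moreover have "finite (carrier ?C)"
    using finite_Bij[OF fin] subgroup.subset[OF C] by (auto intro: finite_subset)
  ultimately obtain n where "order ?C = p ^ n" using C.p_group_of_pow_eq_one[OF _ p(1)] by blast
  then show ?thesis by (rule C.p_group_nilpotent[OF p(1)])
qed

section \<open>Assembly from the Sylow subgroups\<close>

lemma two_closure_subgroups_product:
  assumes fin: "finite \<Omega>" and G: "subgroup G (BijGroup \<Omega>)"
    and nil: "nilpotent_group ((BijGroup \<Omega>)\<lparr>carrier := G\<rparr>)"
    and "\<And>H. H \<in> set Hs \<Longrightarrow> subgroup H ((BijGroup \<Omega>)\<lparr>carrier := G\<rparr>)"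
    and "\<And>H. H \<in> set Hs \<Longrightarrow> \<exists>p k. prime p \<and> card H = p ^ k"
    and "sorted_wrt (\<lambda>H K. coprime (card H) (card K)) Hs"
  shows "two_closure \<Omega> (subgroups_product (BijGroup \<Omega>) Hs) =
      subgroups_product (BijGroup \<Omega>) (map (two_closure \<Omega>) Hs) \<and>
    nilpotent_group ((BijGroup \<Omega>)\<lparr>carrier := two_closure \<Omega> (subgroups_product (BijGroup \<Omega>) Hs)\<rparr>)"
  using assms(4-)
\<comment> \<open>Each step splits off the first subgroup \<open>H\<close>, which commutes with the
  product of the others because \<open>G\<close> is nilpotent and the orders are coprime. The
  closure of that product enters as a nilpotent factor, so nilpotency is proved along with the
  formula.\<close>
proof (induction Hs)
  case Nil
  have "nilpotent_group ((BijGroup \<Omega>)\<lparr>carrier := {\<one>\<^bsub>BijGroup \<Omega>\<^esub>}\<rparr>)"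
    using group.subgroup_imp_group[OF group_BijGroup group.triv_subgroup[OF group_BijGroup]]
    by (auto simp: nilpotent_group_def intro!: exI[of _ 0])
  then show ?case by (simp add: two_closure_trivial)
next
  case (Cons H Hs)
  let ?S = "BijGroup \<Omega>" and ?G = "(BijGroup \<Omega>)\<lparr>carrier := G\<rparr>"
  interpret S: group ?S by (rule group_BijGroup)
  interpret G: group ?G by (rule S.subgroup_imp_group[OF G])
  let ?K = "subgroups_product ?S Hs"
  have HG: "subgroup H ?G" using Cons.prems(1) by simp
  have srt: "sorted_wrt (\<lambda>H K. coprime (card H) (card K)) Hs" using Cons.prems(3) by simp
  have subs: "\<And>H. H \<in> set Hs \<Longrightarrow> subgroup H ?G" using Cons.prems(1) by simp
  have KG: "subgroup ?K ?G"
    using G.nilpotent_subgroups_product(1)[OF nil subs srt] by simp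
  have co: "coprime (card H) (card ?K)"
    using G.nilpotent_subgroups_product(3)[OF nil subs srt, of "card H"] Cons.prems(3) by simp
  have H: "subgroup H ?S" and K: "subgroup ?K ?S"
    using S.incl_subgroup[OF G] HG KG by blast+
  have comm: "a \<otimes>\<^bsub>?S\<^esub> b = b \<otimes>\<^bsub>?S\<^esub> a" if "a \<in> H" "b \<in> ?K" for a b
    using G.nilpotent_coprime_commute[OF nil _ _ _ _ co] G.pow_card_subgroup[OF HG that(1)]
      G.pow_card_subgroup[OF KG that(2)] subgroup.mem_carrier[OF HG that(1)]
      subgroup.mem_carrier[OF KG that(2)] by simp
  have IH: "two_closure \<Omega> ?K = subgroups_product ?S (map (two_closure \<Omega>) Hs)"
    "nilpotent_group (?S\<lparr>carrier := two_closure \<Omega> ?K\<rparr>)"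
    using Cons.IH[OF subs _ srt] Cons.prems(2) by (auto simp del: carrier_BijGroup)
  have eq: "two_closure \<Omega> (H <#>\<^bsub>?S\<^esub> ?K) = two_closure \<Omega> H <#>\<^bsub>?S\<^esub> two_closure \<Omega> ?K"
    by (rule two_closure_coprime_product[OF fin H K co comm])
  obtain p k where "prime p" "card H = p ^ k" using Cons.prems(2)[of H] by auto
  then have "nilpotent_group (?S\<lparr>carrier := two_closure \<Omega> H\<rparr>)"
    by (rule two_closure_p_group_nilpotent[OF fin H])
  then have "nilpotent_group (?S\<lparr>carrier := two_closure \<Omega> H <#>\<^bsub>?S\<^esub> two_closure \<Omega> ?K\<rparr>)"
    using two_closures_commute[OF H K comm] IH(2)
    by (intro S.nilpotent_commuting_set_mult subgroup_two_closure H K)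
  then show ?case using eq IH(1) by simp
qed

theorem theorem1p1:
  fixes \<Omega> :: "'a set" and G :: "('a \<Rightarrow> 'a) set"
  assumes "finite \<Omega>"
    and "subgroup G (BijGroup \<Omega>)"
    and "nilpotent_group ((BijGroup \<Omega>)\<lparr>carrier := G\<rparr>)"
  shows "nilpotent_group ((BijGroup \<Omega>)\<lparr>carrier := two_closure \<Omega> G\<rparr>) \<and>
    (\<forall>Ps. distinct Ps \<and> set Ps = sylow_subgroups ((BijGroup \<Omega>)\<lparr>carrier := G\<rparr>) \<longrightarrow>
      two_closure \<Omega> G = subgroups_product (BijGroup \<Omega>) (map (two_closure \<Omega>) Ps))"
proof -
  let ?S = "BijGroup \<Omega>" and ?G = "(BijGroup \<Omega>)\<lparr>carrier := G\<rparr>"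
  interpret S: group ?S by (rule group_BijGroup)
  interpret G: group ?G by (rule S.subgroup_imp_group[OF assms(2)])
  have finG: "finite G"
    using finite_Bij[OF assms(1)] subgroup_BijD[OF assms(2)] by (meson finite_subset subsetI)
  have main: "two_closure \<Omega> G = subgroups_product ?S (map (two_closure \<Omega>) Ps) \<and>
      nilpotent_group (?S\<lparr>carrier := two_closure \<Omega> G\<rparr>)"
    if Ps: "distinct Ps" "set Ps = sylow_subgroups ?G" for Ps
  proof -
    note np = G.nilpotent_product_sylow_subgroups[OF assms(3) _ Ps]
    have "subgroups_product ?S Ps = G" using np(2) finG by simp
    then show ?thesis
      using two_closure_subgroups_product[OF assms, of Ps] np(1) finG Ps(2)
      by (auto simp: sylow_subgroups_def)
  qed
  moreover have "P \<in> Pow G" if "P \<in> sylow_subgroups ?G" for P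
    using subgroup.subset[of P ?G] that by (simp add: sylow_subgroups_def)
  \<comment> \<open>Nilpotency of the closure also comes from \<open>main\<close>, which takes an
    enumeration of the Sylow subgroups; finiteness provides one.\<close>
  then have "finite (sylow_subgroups ?G)"
    using finG by (meson finite_Pow_iff finite_subset subsetI)
  then obtain Ps where "distinct Ps" "set Ps = sylow_subgroups ?G"
    using finite_distinct_list by blast
  ultimately show ?thesis by blast
qed

end
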